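(* Let $L$ be a locally compact Hausdorff topological space and $Y$ a complex Banach space, where $C_0(L)$ and $Y$ have dimension at least two. If $Y$ is $\mathbb C$-uniformly convex, then the pair $(C_0(L),Y)$ has the BPBp-RSE, where $C_0(L)$ denotes the complex Banach space of complex-valued continuous functions on $L$ vanishing at infinity, with the supremum norm. If, moreover, $L$ is not connected, the converse also holds: if $(C_0(L),Y)$ has the BPBp-RSE, then $Y$ is $\mathbb C$-uniformly convex.
   Context: All Banach spaces here are complex; $B_X$, $S_X$ are the closed unit ball and unit sphere of $X$; $\mathbb T=\{\lambda\in\mathbb C:|\lambda|=1\}$; $\mathcal L(X,Y)$ is the space of bounded linear operators. An operator $T\in\mathcal L(X,Y)$ is range strongly exposing, $T\in\mathrm{RSE}(X,Y)$, if there is $x_0\in S_X$ such that whenever $(x_n)\subseteq B_X$ satisfies $\|Tx_n\|\to\|T\|$, there are a subsequence $(x_{\sigma(n)})$ and $\lambda\in\mathbb T$ with $Tx_{\sigma(n)}\to\lambda Tx_0$. The pair $(X,Y)$ has the BPBp-RSE if for every $\varepsilon>0$ there is $0<\eta(\varepsilon)<\varepsilon$ such that for every $T\in\mathcal L(X,Y)$ with $\|T\|=1$ and every $x\in S_X$ with $\|Tx\|>1-\eta(\varepsilon)$, there exist $S\in\mathrm{RSE}(X,Y)$ and $x_0\in S_X$ with $\|S\|=\|Sx_0\|=1$, $\|S-T\|<\varepsilon$ and $\|x-x_0\|<\varepsilon$. A complex Banach space $Y$ is $\mathbb C$-uniformly convex if for every $\varepsilon>0$ there is $\delta>0$ such that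 whenever $y_0,y_1\in Y$ satisfy $\|y_0+wy_1\|\le 1$ for every $w\in\mathbb T$ and $\|y_1\|>\varepsilon$, one has $\|y_0\|<1-\delta$. *)

theory Defs
  imports "HOL-Analysis.Analysis"
begin

section \<open>Complex Banach spaces\<close>

class scaleC =
  fixes scaleC :: "complex \<Rightarrow> 'a \<Rightarrow> 'a" (infixr "*\<^sub>C" 75)

class complex_normed_vector = real_normed_vector + scaleC +
  assumes scaleC_add_right: "a *\<^sub>C (x + y) = a *\<^sub>C x + a *\<^sub>C y"
    and scaleC_add_left: "(a + b) *\<^sub>C x = a *\<^sub>C x + b *\<^sub>C x"
    and scaleC_scaleC: "a *\<^sub>C b *\<^sub>C x = (a * b) *\<^sub>C x"
    and scaleR_scaleC: "r *\<^sub>R x = complex_of_real r *\<^sub>C x"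
    and norm_scaleC: "norm (a *\<^sub>C x) = cmod a * norm x"

class cbanach = complex_normed_vector + complete_space

global_interpretation complex_vector:
  vector_space "scaleC :: complex \<Rightarrow> 'a \<Rightarrow> 'a::complex_normed_vector"
  defines cdependent = complex_vector.dependent
proof
  show "1 *\<^sub>C x = x" for x :: 'a
    using scaleR_scaleC[of 1 x] by simp
qed (fact scaleC_add_right scaleC_add_left scaleC_scaleC)+

text \<open>
  The library's \<^const>\<open>vector_space.dim\<close> is 0 on infinite-dimensional spaces, so a lower bound on
  the dimension is stated through linearly independent sets.
\<close>

definition cdim_ge :: "nat \<Rightarrow> 'a::complex_normed_vector itself \<Rightarrow> bool" where
  "cdim_ge n _ \<longleftrightarrow> (\<exists>B :: 'a set. finite B \<and> card B = n \<and> \<not> cdependent B)"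


section \<open>The space of continuous functions vanishing at infinity\<close>

definition vanishes_at_infinity :: "('l::topological_space \<Rightarrow> complex) \<Rightarrow> bool" where
  "vanishes_at_infinity f \<longleftrightarrow> (\<forall>e>0. \<exists>K. compact K \<and> (\<forall>x. x \<notin> K \<longrightarrow> cmod (f x) < e))"

typedef (overloaded) ('l::topological_space) c0 =
  "{f :: 'l \<Rightarrow> complex. continuous_on UNIV f \<and> vanishes_at_infinity f}"
  morphisms apply_c0 Abs_c0
  by (rule exI[of _ "\<lambda>_. 0"]) (auto simp: vanishes_at_infinity_def)

setup_lifting type_definition_c0

lemma continuous_on_apply_c0: "continuous_on UNIV (apply_c0 f)"
  and vanishes_at_infinity_apply_c0: "vanishes_at_infinity (apply_c0 f)"
  using apply_c0[of f] by auto

lemma vanishes_at_infinity_add: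
  assumes "vanishes_at_infinity f" "vanishes_at_infinity g"
  shows "vanishes_at_infinity (\<lambda>x. f x + g x)"
  unfolding vanishes_at_infinity_def
proof (intro allI impI)
  fix e :: real assume "e > 0"
  then have "e / 2 > 0" by simp
  obtain K where K: "compact K" "\<And>x. x \<notin> K \<Longrightarrow> cmod (f x) < e / 2"
    using assms(1) \<open>e / 2 > 0\<close> unfolding vanishes_at_infinity_def by blast
  obtain K' where K': "compact K'" "\<And>x. x \<notin> K' \<Longrightarrow> cmod (g x) < e / 2"
    using assms(2) \<open>e / 2 > 0\<close> unfolding vanishes_at_infinity_def by blast
  have "cmod (f x + g x) < e" if "x \<notin> K \<union> K'" for x
    using K(2)[of x] K'(2)[of x] that norm_triangle_ineq[of "f x" "g x"] by auto
  then show "\<exists>K. compact K \<and> (\<forall>x. x \<notin> K \<longrightarrow> cmod (f x + g x) < e)"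
    using K(1) K'(1) by (intro exI[of _ "K \<union> K'"]) (auto intro: compact_Un)
qed

lemma vanishes_at_infinity_mult:
  assumes "vanishes_at_infinity f"
  shows "vanishes_at_infinity (\<lambda>x. c * f x)"
  unfolding vanishes_at_infinity_def
proof (intro allI impI)
  fix e :: real assume "e > 0"
  then have pos: "e / (cmod c + 1) > 0"
    by (intro divide_pos_pos add_nonneg_pos) auto
  obtain K where K: "compact K" "\<And>x. x \<notin> K \<Longrightarrow> cmod (f x) < e / (cmod c + 1)"
    using assms pos unfolding vanishes_at_infinity_def by blast
  have "cmod (c * f x) < e" if "x \<notin> K" for x
  proof -
    have "(cmod c + 1) * cmod (f x) < e"
      using K(2)[OF that] by (simp add: pos_less_divide_eq add_nonneg_pos mult.commute)
    then show ?thesis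
      by (simp add: norm_mult algebra_simps) (smt (verit) norm_ge_zero)
  qed
  then show "\<exists>K. compact K \<and> (\<forall>x. x \<notin> K \<longrightarrow> cmod (c * f x) < e)"
    using K(1) by blast
qed

instantiation c0 :: (topological_space) complex_normed_vector
begin

lift_definition zero_c0 :: "'a c0" is "\<lambda>_. 0"
  by (auto simp: vanishes_at_infinity_def)

lift_definition plus_c0 :: "'a c0 \<Rightarrow> 'a c0 \<Rightarrow> 'a c0" is "\<lambda>f g x. f x + g x"
  by (auto intro: continuous_on_add vanishes_at_infinity_add)

lift_definition uminus_c0 :: "'a c0 \<Rightarrow> 'a c0" is "\<lambda>f x. - f x"
  by (auto intro: continuous_on_minus simp: vanishes_at_infinity_def)

lift_definition minus_c0 :: "'a c0 \<Rightarrow> 'a c0 \<Rightarrow> 'a c0" is "\<lambda>f g x. f x - g x"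
  using vanishes_at_infinity_add[OF _ vanishes_at_infinity_mult[of _ "-1"]]
  by (auto intro: continuous_on_diff)

lift_definition scaleC_c0 :: "complex \<Rightarrow> 'a c0 \<Rightarrow> 'a c0" is "\<lambda>c f x. c * f x"
  by (auto intro: continuous_on_mult_left vanishes_at_infinity_mult)

lift_definition scaleR_c0 :: "real \<Rightarrow> 'a c0 \<Rightarrow> 'a c0" is "\<lambda>r f x. r *\<^sub>R f x"
  by (auto intro: continuous_on_mult_left vanishes_at_infinity_mult simp: scaleR_conv_of_real)

lift_definition norm_c0 :: "'a c0 \<Rightarrow> real" is "\<lambda>f. SUP x. cmod (f x)" .

definition dist_c0 :: "'a c0 \<Rightarrow> 'a c0 \<Rightarrow> real" where
  "dist_c0 f g = norm (f - g)"

definition sgn_c0 :: "'a c0 \<Rightarrow> 'a c0" where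
  "sgn_c0 f = inverse (norm f) *\<^sub>R f"

definition uniformity_c0 :: "('a c0 \<times> 'a c0) filter" where
  "uniformity_c0 = (INF e\<in>{0<..}. principal {(f, g). dist f g < e})"

definition open_c0 :: "'a c0 set \<Rightarrow> bool" where
  "open_c0 U \<longleftrightarrow> (\<forall>f\<in>U. \<forall>\<^sub>F (f', g) in uniformity. f' = f \<longrightarrow> g \<in> U)"

lemma bdd_above_cmod_c0: "bdd_above (range (\<lambda>x. cmod (apply_c0 f x)))"
proof -
  obtain K where K: "compact K" "\<And>x. x \<notin> K \<Longrightarrow> cmod (apply_c0 f x) < 1"
    using vanishes_at_infinity_apply_c0[of f] unfolding vanishes_at_infinity_def
    by (metis zero_less_one)
  have "bounded (apply_c0 f ` K)"
    by (intro compact_imp_bounded compact_continuous_image K(1))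
       (rule continuous_on_subset[OF continuous_on_apply_c0], simp)
  then obtain B where B: "\<And>x. x \<in> K \<Longrightarrow> cmod (apply_c0 f x) \<le> B"
    unfolding bounded_iff by auto
  have "cmod (apply_c0 f x) \<le> max B 1" for x
    using B[of x] K(2)[of x] by (cases "x \<in> K") auto
  then show ?thesis by (rule bdd_aboveI2)
qed

lemma cmod_apply_c0_le_norm: "cmod (apply_c0 f x) \<le> norm f"
  unfolding norm_c0.rep_eq by (rule cSUP_upper[OF _ bdd_above_cmod_c0]) simp

lemma norm_c0_le: "(\<And>x. cmod (apply_c0 f x) \<le> b) \<Longrightarrow> norm f \<le> b"
  unfolding norm_c0.rep_eq by (rule cSUP_least) auto

lemma norm_scaleC_c0: "norm (a *\<^sub>C f) = cmod a * norm f" for f :: "'a c0"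
proof (rule antisym)
  show le: "norm (a *\<^sub>C f) \<le> cmod a * norm f" for a :: complex and f :: "'a c0"
    by (rule norm_c0_le)
       (simp add: scaleC_c0.rep_eq norm_mult mult_left_mono cmod_apply_c0_le_norm)
  show "cmod a * norm f \<le> norm (a *\<^sub>C f)"
  proof (cases "a = 0")
    case True
    then show ?thesis
      using order_trans[OF norm_ge_zero cmod_apply_c0_le_norm[of "a *\<^sub>C f"]] by simp
  next
    case False
    then have "f = inverse a *\<^sub>C (a *\<^sub>C f)"
      by transfer (auto simp: fun_eq_iff)
    then have "norm f \<le> cmod (inverse a) * norm (a *\<^sub>C f)"
      using le[of "inverse a" "a *\<^sub>C f"] by simp
    then show ?thesis
      using False by (simp add: norm_inverse norm_divide field_simps)
  qed
qed

instance
proof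
  fix f g h :: "'a c0" and a b :: complex and r s :: real
  show "f + g + h = f + (g + h)" "f + g = g + f" "0 + f = f" "- f + f = 0" "f - g = f + - g"
    "r *\<^sub>R (f + g) = r *\<^sub>R f + r *\<^sub>R g" "(r + s) *\<^sub>R f = r *\<^sub>R f + s *\<^sub>R f"
    "r *\<^sub>R s *\<^sub>R f = (r * s) *\<^sub>R f" "1 *\<^sub>R f = f"
    "a *\<^sub>C (f + g) = a *\<^sub>C f + a *\<^sub>C g" "(a + b) *\<^sub>C f = a *\<^sub>C f + b *\<^sub>C f"
    "a *\<^sub>C b *\<^sub>C f = (a * b) *\<^sub>C f"
    by (transfer; simp add: fun_eq_iff algebra_simps)+
  show scaleR: "r *\<^sub>R f = complex_of_real r *\<^sub>C f"
    by transfer (simp add: scaleR_conv_of_real)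
  show "norm (a *\<^sub>C f) = cmod a * norm f"
    by (rule norm_scaleC_c0)
  then show "norm (r *\<^sub>R f) = \<bar>r\<bar> * norm f"
    by (simp add: scaleR norm_scaleC_c0)
  show "norm f = 0 \<longleftrightarrow> f = 0"
  proof
    assume "norm f = 0"
    then have "apply_c0 f x = 0" for x
      using cmod_apply_c0_le_norm[of f x] by simp
    then show "f = 0"
      by transfer (simp add: fun_eq_iff)
  qed (transfer, simp)
  show "norm (f + g) \<le> norm f + norm g"
    by (rule norm_c0_le)
       (auto simp: plus_c0.rep_eq intro!: norm_triangle_le add_mono cmod_apply_c0_le_norm)
qed (fact dist_c0_def sgn_c0_def uniformity_c0_def open_c0_def)+

end

instance c0 :: (topological_space) cbanach
proof
  fix F :: "nat \<Rightarrow> 'a c0"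
  assume "Cauchy F"
  have le: "dist (apply_c0 f x) (apply_c0 g x) \<le> dist f g" for f g :: "'a c0" and x
    using cmod_apply_c0_le_norm[of "f - g" x] by (simp add: dist_norm minus_c0.rep_eq)
  have "\<exists>g. uniform_limit UNIV (\<lambda>n. apply_c0 (F n)) g sequentially"
    using uniformly_convergent_eq_cauchy[of "\<lambda>_. True" "\<lambda>n. apply_c0 (F n)"] \<open>Cauchy F\<close> le
    unfolding Cauchy_def uniform_limit_sequentially_iff
    by (metis le_less_trans)
  then obtain g where g: "uniform_limit UNIV (\<lambda>n. apply_c0 (F n)) g sequentially" ..
  have cont: "continuous_on UNIV g"
    by (rule uniform_limit_theorem[OF _ g]) (auto simp: continuous_on_apply_c0)
  have "vanishes_at_infinity g"
    unfolding vanishes_at_infinity_def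
  proof (intro allI impI)
    fix e :: real assume "e > 0"
    then have e: "e / 2 > 0" by simp
    obtain n where n: "\<And>x. dist (apply_c0 (F n) x) (g x) < e / 2"
      using uniform_limitD[OF g e] by (auto simp: eventually_sequentially)
    obtain K where K: "compact K" "\<And>x. x \<notin> K \<Longrightarrow> cmod (apply_c0 (F n) x) < e / 2"
      using vanishes_at_infinity_apply_c0[of "F n"] e unfolding vanishes_at_infinity_def by blast
    have "cmod (g x) < e" if "x \<notin> K" for x
      using n[of x] K(2)[OF that] norm_triangle_sub[of "g x" "apply_c0 (F n) x"]
      by (simp add: dist_norm norm_minus_commute)
    then show "\<exists>K. compact K \<and> (\<forall>x. x \<notin> K \<longrightarrow> cmod (g x) < e)"
      using K(1) by blast
  qed
  with cont have G: "apply_c0 (Abs_c0 g) = g"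
    by (simp add: Abs_c0_inverse)
  have "F \<longlonglongrightarrow> Abs_c0 g"
  proof (rule tendstoI)
    fix e :: real assume "e > 0"
    then have e: "e / 2 > 0" by simp
    show "\<forall>\<^sub>F n in sequentially. dist (F n) (Abs_c0 g) < e"
      using uniform_limitD[OF g e]
    proof eventually_elim
      case (elim n)
      have "dist (F n) (Abs_c0 g) \<le> e / 2"
        unfolding dist_norm
        by (rule norm_c0_le) (use elim in \<open>auto simp: minus_c0.rep_eq G dist_norm intro: less_imp_le\<close>)
      then show ?case using \<open>e > 0\<close> by simp
    qed
  qed
  then show "convergent F" by (rule convergentI)
qed


section \<open>Range strongly exposing operators and the BPBp-RSE\<close>

text \<open>
  The type \<^typ>\<open>'a \<Rightarrow>\<^sub>L 'b\<close> consists of the bounded \<^emph>\<open>real\<close>-linear maps with the operator norm; the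
  space of bounded complex-linear operators is the following subset of it.
\<close>

definition clinear_ops ::
    "('a::complex_normed_vector \<Rightarrow>\<^sub>L 'b::complex_normed_vector) set" where
  "clinear_ops = {T. \<forall>c x. blinfun_apply T (c *\<^sub>C x) = c *\<^sub>C blinfun_apply T x}"

definition RSE :: "('a::complex_normed_vector \<Rightarrow>\<^sub>L 'b::complex_normed_vector) set" where
  "RSE = {T \<in> clinear_ops. \<exists>x0. norm x0 = 1 \<and>
     (\<forall>x :: nat \<Rightarrow> 'a. (\<forall>n. norm (x n) \<le> 1) \<longrightarrow>
        (\<lambda>n. norm (blinfun_apply T (x n))) \<longlonglongrightarrow> norm T \<longrightarrow>
        (\<exists>\<sigma> :: nat \<Rightarrow> nat. \<exists>\<theta> :: complex. strict_mono \<sigma> \<and> cmod \<theta> = 1 \<and>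
           (\<lambda>n. blinfun_apply T (x (\<sigma> n))) \<longlonglongrightarrow> \<theta> *\<^sub>C blinfun_apply T x0))}"

definition BPBp_RSE ::
    "'a::complex_normed_vector itself \<Rightarrow> 'b::complex_normed_vector itself \<Rightarrow> bool" where
  "BPBp_RSE _ _ \<longleftrightarrow>
     (\<forall>\<epsilon>>0. \<exists>\<eta>. 0 < \<eta> \<and> \<eta> < \<epsilon> \<and>
        (\<forall>T \<in> (clinear_ops :: ('a \<Rightarrow>\<^sub>L 'b) set). \<forall>x.
           norm T = 1 \<and> norm x = 1 \<and> norm (blinfun_apply T x) > 1 - \<eta> \<longrightarrow>
           (\<exists>S \<in> RSE. \<exists>x0. norm x0 = 1 \<and> norm S = 1 \<and> norm (blinfun_apply S x0) = 1 \<and>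
              norm (S - T) < \<epsilon> \<and> norm (x - x0) < \<epsilon>)))"

definition C_uniformly_convex :: "'a::complex_normed_vector itself \<Rightarrow> bool" where
  "C_uniformly_convex _ \<longleftrightarrow>
     (\<forall>\<epsilon>>0. \<exists>\<delta>>0. \<forall>y0 y1 :: 'a.
        (\<forall>w. cmod w = 1 \<longrightarrow> norm (y0 + w *\<^sub>C y1) \<le> 1) \<and> norm y1 > \<epsilon> \<longrightarrow> norm y0 < 1 - \<delta>)"

end

theory Submission
  imports Defs
begin

text \<open>
  Let \<open>X\<close> be the space of continuous functions vanishing at infinity and \<open>Y\<close> the range space.

  The sufficiency rests on the observation that, when \<open>Y\<close> is complex uniformly convex, every
  operator from \<open>X\<close> to \<open>Y\<close> sees its domain as an ordinarily uniformly convex space: if two functions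
  \<open>f\<close>, \<open>g\<close> in the unit ball have a midpoint at which the operator almost attains its norm, the operator is
  small at every function dominated by \<open>f - g\<close> (\<open>operator_uniform_convexity\<close>). This follows from the
  uniform convexity of the plane, which makes the modulus of the midpoint drop where \<open>f\<close> and \<open>g\<close> differ,
  so that complex uniform convexity can be applied to the midpoint perturbed by small multiples of a
  function supported there. The argument is pointwise in the functions and needs no representing measures.

  Given an operator \<open>T\<close> that almost attains its norm at \<open>f0\<close>, the operator is first cut off to the
  set where \<open>f0\<close> has modulus close to 1, and \<open>f0\<close> is replaced by a nearby function \<open>f\<close> that is unimodular
  there (\<open>carry_near_modulus_one\<close>). Then \<open>f\<close> stays fixed and only the operator is improved. A
  rank-one perturbation of Lindenstrauss type, \<open>u \<mapsto> T u + e \<phi>(u) T f\<close> with \<open>\<phi>\<close> the composition of \<open>T\<close>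
  and a norming functional of \<open>T f\<close>, has near-maximizers \<open>g\<close> that are, after a rotation, close to \<open>f\<close>
  as far as \<open>T\<close> can see. Composing it with multiplication by \<open>g\<close> times the conjugate of \<open>f\<close> transports
  the near-maximizer \<open>g\<close> to \<open>f\<close> (\<open>improvement_step\<close>). Iteration gives an operator attaining its
  norm exactly at \<open>f\<close> (\<open>attain_norm_at_carrier\<close>), and one more rank-one perturbation makes it range strongly
  exposing (\<open>norm_attaining_near_RSE\<close>).

  For the necessity, a disconnection of the underlying space splits \<open>X\<close> into a supremum sum of two nonzero
  spaces. A range strongly exposing operator that attains its norm at \<open>x\<close> must kill every \<open>v\<close> with
  both \<open>x + v\<close> and \<open>x - v\<close> in the unit ball (\<open>RSE_vanishes_beside_maximizer\<close>). A pair \<open>y0\<close>, \<open>y1\<close>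
  violating complex uniform convexity gives an operator equal to \<open>y0\<close> times a functional on the first summand and
  \<open>y1\<close> times a functional on the second. It almost attains its norm on the first summand, but a range strongly
  exposing operator attaining its norm near there vanishes on the second, so it is not a good approximation.
\<close>

section \<open>Continuous functions vanishing at infinity as an algebra\<close>

instance cbanach \<subseteq> banach ..

instantiation c0 :: (topological_space) real_normed_algebra
begin

lift_definition times_c0 :: "'a c0 \<Rightarrow> 'a c0 \<Rightarrow> 'a c0" is "\<lambda>f g x. f x * g x"
proof -
  fix f g :: "'a \<Rightarrow> complex"
  assume f: "continuous_on UNIV f \<and> vanishes_at_infinity f"
    and g: "continuous_on UNIV g \<and> vanishes_at_infinity g"
  have "vanishes_at_infinity (\<lambda>x. f x * g x)"
    unfolding vanishes_at_infinity_def
  proof (intro allI impI)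
    fix e :: real assume "e > 0"
    then have e: "min e 1 > 0" by simp
    obtain K where K: "compact K" "\<And>x. x \<notin> K \<Longrightarrow> cmod (f x) < min e 1"
      using f e unfolding vanishes_at_infinity_def by blast
    obtain K' where K': "compact K'" "\<And>x. x \<notin> K' \<Longrightarrow> cmod (g x) < min e 1"
      using g e unfolding vanishes_at_infinity_def by blast
    have "cmod (f x * g x) < e" if "x \<notin> K \<union> K'" for x
    proof -
      have "cmod (f x) * cmod (g x) \<le> cmod (f x) * 1"
        using K'(2)[of x] that by (intro mult_left_mono) auto
      then show ?thesis using K(2)[of x] that by (simp add: norm_mult)
    qed
    then show "\<exists>K. compact K \<and> (\<forall>x. x \<notin> K \<longrightarrow> cmod (f x * g x) < e)"
      using K(1) K'(1) by (intro exI[of _ "K \<union> K'"]) (auto intro: compact_Un)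
  qed
  then show "continuous_on UNIV (\<lambda>x. f x * g x) \<and> vanishes_at_infinity (\<lambda>x. f x * g x)"
    using f g by (auto intro: continuous_on_mult)
qed

instance
proof
  fix f g h :: "'a c0" and r :: real
  show "f * g * h = f * (g * h)" "(f + g) * h = f * h + g * h" "f * (g + h) = f * g + f * h"
    "r *\<^sub>R f * g = r *\<^sub>R (f * g)" "f * r *\<^sub>R g = r *\<^sub>R (f * g)"
    by (transfer; simp add: fun_eq_iff algebra_simps)+
  show "norm (f * g) \<le> norm f * norm g"
    by (rule norm_c0_le)
       (simp add: times_c0.rep_eq norm_mult mult_mono cmod_apply_c0_le_norm)
qed

end

lift_definition cnj_c0 :: "'a::topological_space c0 \<Rightarrow> 'a c0" is "\<lambda>f x. cnj (f x)"
  by (auto intro: continuous_on_cnj simp: vanishes_at_infinity_def)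

lemmas apply_c0_simps = zero_c0.rep_eq plus_c0.rep_eq minus_c0.rep_eq uminus_c0.rep_eq
  scaleC_c0.rep_eq scaleR_c0.rep_eq times_c0.rep_eq cnj_c0.rep_eq

lemma c0_eqI: "(\<And>x. apply_c0 f x = apply_c0 g x) \<Longrightarrow> f = g"
  by transfer (simp add: fun_eq_iff)

lemma scaleC_mult_c0: "c *\<^sub>C f * g = c *\<^sub>C (f * g)" "f * c *\<^sub>C g = c *\<^sub>C (f * g)"
  for f :: "'a::topological_space c0"
  by (rule c0_eqI, simp add: apply_c0_simps)+

lemma cmod_apply_c0_le_one: "norm f \<le> 1 \<Longrightarrow> cmod (apply_c0 f x) \<le> 1"
  using cmod_apply_c0_le_norm[of f x] by simp

text \<open>
  The function \<^term>\<open>F \<circ> apply_c0 f\<close> lies in the space only if \<^term>\<open>F\<close> is continuous and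
  fixes 0; for other \<^term>\<open>F\<close> the value is meaningless.
\<close>

definition comp_c0 :: "(complex \<Rightarrow> complex) \<Rightarrow> 'a::topological_space c0 \<Rightarrow> 'a c0" where
  "comp_c0 F f = Abs_c0 (\<lambda>x. F (apply_c0 f x))"

lemma apply_comp_c0:
  assumes "continuous_on UNIV F" "F 0 = 0"
  shows "apply_c0 (comp_c0 F f) x = F (apply_c0 f x)"
proof -
  have "vanishes_at_infinity (\<lambda>x. F (apply_c0 f x))"
    unfolding vanishes_at_infinity_def
  proof (intro allI impI)
    fix e :: real assume "e > 0"
    moreover have "isCont F 0"
      using assms(1) by (simp add: continuous_on_eq_continuous_at)
    ultimately obtain d where d: "d > 0" "\<And>z. cmod z < d \<Longrightarrow> cmod (F z) < e"
      using assms(2) unfolding continuous_at dist_norm by (metis LIM_eq assms(2) diff_zero norm_zero)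
    obtain K where "compact K" "\<And>x. x \<notin> K \<Longrightarrow> cmod (apply_c0 f x) < d"
      using vanishes_at_infinity_apply_c0[of f] d(1) unfolding vanishes_at_infinity_def by blast
    then show "\<exists>K. compact K \<and> (\<forall>x. x \<notin> K \<longrightarrow> cmod (F (apply_c0 f x)) < e)"
      using d(2) by blast
  qed
  moreover have "continuous_on UNIV (\<lambda>x. F (apply_c0 f x))"
    by (rule continuous_on_compose2[OF assms(1) continuous_on_apply_c0]) simp
  ultimately show ?thesis
    unfolding comp_c0_def by (simp add: Abs_c0_inverse)
qed

text \<open>
  The nearest-point retraction of the plane onto the closed disc of radius \<^term>\<open>r\<close>.
\<close>

definition radial_cut :: "real \<Rightarrow> complex \<Rightarrow> complex" where
  "radial_cut r z = (r / max r (cmod z)) *\<^sub>R z"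

lemma apply_radial_cut_c0:
  "r > 0 \<Longrightarrow> apply_c0 (comp_c0 (radial_cut r) f) x = radial_cut r (apply_c0 f x)"
  by (rule apply_comp_c0) (auto simp: radial_cut_def intro!: continuous_intros)

lemma norm_radial_cut: "r > 0 \<Longrightarrow> cmod (radial_cut r z) = min r (cmod z)"
  by (auto simp: radial_cut_def max_def min_def)

lemma norm_diff_radial_cut: 
  assumes "r > 0" shows "cmod (z - radial_cut r z) = max 0 (cmod z - r)"
proof (cases "cmod z \<le> r")
  case False
  have "z - radial_cut r z = (1 - r / cmod z) *\<^sub>R z"
    using False by (simp add: radial_cut_def max_def algebra_simps)
  then have "cmod (z - radial_cut r z) = \<bar>1 - r / cmod z\<bar> * cmod z"
    by simp
  also have "\<dots> = cmod z - r"
    using False assms by (subst abs_of_nonneg) (auto simp: divide_le_eq_1 left_diff_distrib)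
  finally show ?thesis using False by simp
qed (use assms in \<open>auto simp: radial_cut_def max_def\<close>)

lemma exists_unimodular_mult: "\<exists>a. cmod a = 1 \<and> a * c = complex_of_real (cmod c)"
proof (cases "c = 0")
  case False
  then show ?thesis
    by (intro exI[of _ "cnj c / cmod c"])
       (simp add: norm_divide mult.commute complex_norm_square[symmetric] power2_eq_square)
qed (auto intro: exI[of _ 1])

section \<open>Norming functionals\<close>

definition sublinear :: "('a::real_vector \<Rightarrow> real) \<Rightarrow> bool" where
  "sublinear p \<longleftrightarrow> (\<forall>x y. p (x + y) \<le> p x + p y) \<and> (\<forall>r>0. \<forall>x. p (r *\<^sub>R x) = r * p x)"

lemma sublinearI:
  assumes "\<And>x y. p (x + y) \<le> p x + p y" and "\<And>r x. r > 0 \<Longrightarrow> p (r *\<^sub>R x) \<le> r * p x"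
  shows "sublinear p"
  unfolding sublinear_def
proof (intro conjI allI impI assms(1))
  fix r :: real and x assume "r > 0"
  then have "p x \<le> (1 / r) * p (r *\<^sub>R x)"
    using assms(2)[of "1 / r" "r *\<^sub>R x"] by simp
  then show "p (r *\<^sub>R x) = r * p x"
    using assms(2)[OF \<open>r > 0\<close>, of x] \<open>r > 0\<close> by (simp add: field_simps)
qed

lemma sublinear_zero: "sublinear p \<Longrightarrow> p 0 = 0"
  unfolding sublinear_def by (metis mult_cancel_right1 scaleR_zero_right zero_less_numeral numeral_eq_one_iff semiring_norm(85))

lemma sublinear_minus: "sublinear p \<Longrightarrow> - p (- x) \<le> p x"
  using sublinear_zero[of p] unfolding sublinear_def by (smt (verit) add.right_inverse)

text \<open>
  For sublinear \<^term>\<open>p\<close> this is the largest sublinear functional below \<^term>\<open>p\<close> whose value at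
  \<^term>\<open>- y\<close> is at most \<^term>\<open>- p y\<close>. It is the device that shows minimal sublinear functionals to be
  linear.
\<close>

definition lower_along :: "('a::real_vector \<Rightarrow> real) \<Rightarrow> 'a \<Rightarrow> 'a \<Rightarrow> real" where
  "lower_along p y x = (INF t\<in>{0..}. p (x + t *\<^sub>R y) - t * p y)"

lemma lower_along_le:
  assumes "sublinear p" "t \<ge> 0"
  shows "lower_along p y x \<le> p (x + t *\<^sub>R y) - t * p y"
  unfolding lower_along_def
proof (rule cINF_lower)
  show "bdd_below ((\<lambda>t. p (x + t *\<^sub>R y) - t * p y) ` {0..})"
  proof (rule bdd_belowI2)
    fix t :: real assume "t \<in> {0..}"
    then have "t * p y = p (t *\<^sub>R y)"
      using assms(1) sublinear_zero[OF assms(1)] by (cases "t = 0") (auto simp: sublinear_def)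
    also have "\<dots> \<le> p (x + t *\<^sub>R y) + p (- x)"
      using assms(1) unfolding sublinear_def by (metis add.commute add_minus_cancel)
    finally show "- p (- x) \<le> p (x + t *\<^sub>R y) - t * p y" by simp
  qed
qed (use assms in auto)

lemma lower_along_greatest:
  assumes "\<And>t. t \<ge> 0 \<Longrightarrow> b \<le> p (x + t *\<^sub>R y) - t * p y"
  shows "b \<le> lower_along p y x"
  unfolding lower_along_def by (rule cINF_greatest) (use assms in auto)

lemma sublinear_lower_along:
  assumes "sublinear p" shows "sublinear (lower_along p y)"
proof (rule sublinearI)
  fix x x'
  have "lower_along p y (x + x') \<le> (p (x + t *\<^sub>R y) - t * p y) + (p (x' + s *\<^sub>R y) - s * p y)"
    if "t \<ge> 0" "s \<ge> 0" for s t
  proof -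
    have "lower_along p y (x + x') \<le> p ((x + t *\<^sub>R y) + (x' + s *\<^sub>R y)) - (t + s) * p y"
      using lower_along_le[OF assms, of "t + s" y "x + x'"] that by (simp add: algebra_simps)
    moreover have "p ((x + t *\<^sub>R y) + (x' + s *\<^sub>R y)) \<le> p (x + t *\<^sub>R y) + p (x' + s *\<^sub>R y)"
      using assms unfolding sublinear_def by blast
    ultimately show ?thesis by (simp add: algebra_simps)
  qed
  note le_sum = this
  have *: "lower_along p y (x + x') - (p (x + t *\<^sub>R y) - t * p y) \<le> lower_along p y x'"
    if "t \<ge> 0" for t
  proof (rule lower_along_greatest)
    fix s :: real assume "s \<ge> 0"
    then show "lower_along p y (x + x') - (p (x + t *\<^sub>R y) - t * p y) \<le> p (x' + s *\<^sub>R y) - s * p y"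
      using le_sum[OF that, of s] by linarith
  qed
  have "lower_along p y (x + x') - lower_along p y x' \<le> lower_along p y x"
  proof (rule lower_along_greatest)
    fix t :: real assume "t \<ge> 0"
    then show "lower_along p y (x + x') - lower_along p y x' \<le> p (x + t *\<^sub>R y) - t * p y"
      using *[of t] by linarith
  qed
  then show "lower_along p y (x + x') \<le> lower_along p y x + lower_along p y x'"
    by simp
next
  fix r :: real and x assume r: "r > 0"
  have "lower_along p y (r *\<^sub>R x) / r \<le> lower_along p y x"
  proof (rule lower_along_greatest)
    fix t :: real assume "t \<ge> 0"
    then have "lower_along p y (r *\<^sub>R x) \<le> p (r *\<^sub>R (x + t *\<^sub>R y)) - (r * t) * p y"
      using lower_along_le[OF assms, of "r * t" y "r *\<^sub>R x"] r by (simp add: algebra_simps)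
    also have "p (r *\<^sub>R (x + t *\<^sub>R y)) = r * p (x + t *\<^sub>R y)"
      using assms r by (simp add: sublinear_def)
    finally show "lower_along p y (r *\<^sub>R x) / r \<le> p (x + t *\<^sub>R y) - t * p y"
      using r by (simp add: field_simps)
  qed
  then show "lower_along p y (r *\<^sub>R x) \<le> r * lower_along p y x"
    using r by (simp add: field_simps)
qed

lemma lower_along_le_self: "sublinear p \<Longrightarrow> lower_along p y x \<le> p x"
  using lower_along_le[of p 0 y x] by simp

text \<open>
  Zorn's lemma applies because the pointwise infimum of a chain of sublinear functionals below
  \<^term>\<open>p\<close> is finite, being bounded below by \<^term>\<open>\<lambda>x. - p (- x)\<close>, and again sublinear.
\<close>

lemma minimal_sublinear_exists:
  fixes p :: "'a::real_vector \<Rightarrow> real"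
  assumes "sublinear p"
  obtains m where "sublinear m" "\<And>x. m x \<le> p x"
    "\<And>q x. sublinear q \<Longrightarrow> (\<And>x. q x \<le> m x) \<Longrightarrow> q x = m x"
proof -
  define A where "A = {q :: 'a \<Rightarrow> real. sublinear q \<and> q \<le> p}"
  let ?R = "relation_of (\<lambda>q q'. q' \<le> q) A"
  have "\<exists>m\<in>A. \<forall>a\<in>A. a \<le> m \<longrightarrow> a = m"
  proof (rule predicate_Zorn)
    show "partial_order_on A ?R"
      by (rule partial_order_on_relation_ofI) auto
    fix C assume C: "C \<in> Chains ?R"
    have CA: "\<And>q. q \<in> C \<Longrightarrow> q \<in> A"
      using C by (auto simp: Chains_def relation_of_def)
    have chain: "q \<le> q' \<or> q' \<le> q" if "q \<in> C" "q' \<in> C" for q q'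
      using C that by (auto simp: Chains_def relation_of_def)
    show "\<exists>u\<in>A. \<forall>a\<in>C. u \<le> a"
    proof (cases "C = {}")
      case True
      then show ?thesis using assms by (auto simp: A_def)
    next
      case False
      define u where "u x = (INF q\<in>C. q x)" for x
      have u_le: "u x \<le> q x" if "q \<in> C" for q x
        unfolding u_def
      proof (rule cINF_lower[OF _ that], rule bdd_belowI2)
        fix q assume "q \<in> C"
        then have "sublinear q" "q (- x) \<le> p (- x)"
          using CA by (auto simp: A_def le_fun_def)
        then show "- p (- x) \<le> q x" using sublinear_minus[of q x] by linarith
      qed
      have le_u: "b \<le> u x" if "\<And>q. q \<in> C \<Longrightarrow> b \<le> q x" for b x
        unfolding u_def using False that by (rule cINF_greatest)
      have "sublinear u"
      proof (rule sublinearI)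
        fix x y
        have *: "u (x + y) \<le> q x + q' y" if qq: "q \<in> C" "q' \<in> C" for q q'
        proof -
          obtain s where "s \<in> C" "s \<le> q" "s \<le> q'"
            using chain[OF qq] qq by (meson order_refl)
          then show ?thesis
            using u_le[of s "x + y"] CA[of s] unfolding A_def sublinear_def le_fun_def
            by (smt (verit) mem_Collect_eq)
        qed
        have "u (x + y) - q x \<le> u y" if "q \<in> C" for q
          using *[OF that] by (intro le_u) (simp add: algebra_simps)
        then have "u (x + y) - u y \<le> u x"
          by (intro le_u) (simp add: algebra_simps)
        then show "u (x + y) \<le> u x + u y" by simp
      next
        fix r :: real and x assume r: "r > 0"
        have "u (r *\<^sub>R x) / r \<le> u x"
        proof (rule le_u)
          fix q assume "q \<in> C"
          then have "u (r *\<^sub>R x) \<le> r * q x"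
            using u_le[of q "r *\<^sub>R x"] CA[of q] r by (simp add: A_def sublinear_def)
          then show "u (r *\<^sub>R x) / r \<le> q x" using r by (simp add: field_simps)
        qed
        then show "u (r *\<^sub>R x) \<le> r * u x" using r by (simp add: field_simps)
      qed
      moreover obtain q where "q \<in> C" using False by blast
      then have "u \<le> p"
        using u_le[of q] CA[of q] by (auto simp: A_def le_fun_def intro: order_trans)
      ultimately show ?thesis
        using u_le by (auto simp: A_def le_fun_def)
    qed
  qed
  then obtain m where m: "sublinear m" "m \<le> p" "\<And>q. sublinear q \<Longrightarrow> q \<le> p \<Longrightarrow> q \<le> m \<Longrightarrow> q = m"
    by (auto simp: A_def)
  show thesis
  proof
    fix q x assume "sublinear q" "\<And>x. q x \<le> m x"
    then show "q x = m x"
      using m(2) m(3)[of q] by (metis le_funI order_trans)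
  qed (use m in \<open>auto simp: le_fun_def\<close>)
qed

text \<open>
  A minimal sublinear functional \<^term>\<open>m\<close> coincides with \<^term>\<open>lower_along m z\<close> for every
  \<^term>\<open>z\<close>, and this gives \<^term>\<open>m x + m z \<le> m (x + z)\<close>. Starting the descent from
  \<^term>\<open>lower_along p y\<close> instead of \<^term>\<open>p\<close> pins down the value at \<^term>\<open>y\<close>.
\<close>

lemma hahn_banach_sublinear:
  fixes p :: "'a::real_vector \<Rightarrow> real"
  assumes p: "sublinear p"
  obtains r where "linear r" "\<And>x. r x \<le> p x" "r y = p y"
proof -
  obtain m where m: "sublinear m" "\<And>x. m x \<le> lower_along p y x"
    and min: "\<And>q x. sublinear q \<Longrightarrow> (\<And>x. q x \<le> m x) \<Longrightarrow> q x = m x"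
    using minimal_sublinear_exists[OF sublinear_lower_along[OF p, of y]] by metis
  have add: "m (x + z) = m x + m z" for x z
  proof -
    have "m x = lower_along m z x"
      by (rule min[symmetric]) (simp_all add: sublinear_lower_along lower_along_le_self m)
    also have "\<dots> \<le> m (x + z) - m z"
      using lower_along_le[OF m(1), of 1 z x] by simp
    finally show ?thesis
      using m(1) by (simp add: sublinear_def order_antisym)
  qed
  have neg: "m (- x) = - m x" for x
    using add[of x "- x"] sublinear_zero[OF m(1)] by simp
  have scale: "m (a *\<^sub>R x) = a * m x" for a x
  proof (cases "a < 0")
    case True
    then have "m ((- a) *\<^sub>R x) = - a * m x"
      using m(1) unfolding sublinear_def by (metis neg_0_less_iff_less)
    then show ?thesis using neg[of "a *\<^sub>R x"] by simp
  next
    case False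
    then show ?thesis
      using m(1) sublinear_zero[OF m(1)] by (cases "a = 0") (auto simp: sublinear_def)
  qed
  show thesis
  proof
    show "linear m" by (rule linearI) (simp_all add: add scale)
    show le: "m x \<le> p x" for x
      using m(2) lower_along_le_self[OF p] by (rule order_trans)
    have "m (- y) \<le> - p y"
      using m(2)[of "- y"] lower_along_le[OF p, of 1 y "- y"] sublinear_zero[OF p] by simp
    then show "m y = p y" using neg[of y] le[of y] by simp
  qed
qed

text \<open>
  A real norming functional \<^term>\<open>r\<close> is complexified as usual to
  \<^term>\<open>\<lambda>v. Complex (r v) (- r (\<i> *\<^sub>C v))\<close>; rotating \<^term>\<open>v\<close> so that the value becomes real shows
  that the norm does not grow.
\<close>

lemma norming_functional:
  fixes y :: "'y::complex_normed_vector"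
  obtains \<psi> :: "'y \<Rightarrow> complex" where "bounded_linear \<psi>" "\<And>c v. \<psi> (c *\<^sub>C v) = c * \<psi> v"
    "\<And>v. cmod (\<psi> v) \<le> norm v" "\<psi> y = norm y"
proof -
  have "sublinear (norm :: 'y \<Rightarrow> real)"
    by (rule sublinearI) (simp_all add: norm_triangle_ineq)
  from hahn_banach_sublinear[OF this, of y]
  obtain r :: "'y \<Rightarrow> real" where r: "linear r" "\<And>v. r v \<le> norm v" "r y = norm y"
    by blast
  define \<psi> where "\<psi> v = Complex (r v) (- r (\<i> *\<^sub>C v))" for v
  have add: "\<psi> (u + v) = \<psi> u + \<psi> v" for u v
    by (simp add: \<psi>_def complex_eq_iff linear_add[OF r(1)] scaleC_add_right)
  have real: "\<psi> (a *\<^sub>R v) = a *\<^sub>R \<psi> v" for a v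
  proof -
    have "\<i> *\<^sub>C a *\<^sub>R v = a *\<^sub>R \<i> *\<^sub>C v"
      by (simp add: scaleR_scaleC scaleC_scaleC mult.commute)
    then show ?thesis
      by (simp add: \<psi>_def complex_eq_iff linear_scale[OF r(1)])
  qed
  have imag: "\<psi> (\<i> *\<^sub>C v) = \<i> * \<psi> v" for v
  proof -
    have "\<i> *\<^sub>C \<i> *\<^sub>C v = (- 1) *\<^sub>R v"
      by (simp add: scaleC_scaleC scaleR_scaleC)
    then have "r (\<i> *\<^sub>C \<i> *\<^sub>C v) = - r v"
      using linear_neg[OF r(1), of v] by simp
    then show ?thesis by (simp add: \<psi>_def complex_eq_iff)
  qed
  have cscale: "\<psi> (c *\<^sub>C v) = c * \<psi> v" for c v
  proof -
    have "c *\<^sub>C v = Re c *\<^sub>R v + Im c *\<^sub>R \<i> *\<^sub>C v"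
      using complex_eq[of c]
      by (metis (no_types) scaleC_add_left scaleC_scaleC scaleR_scaleC mult.commute)
    then have "\<psi> (c *\<^sub>C v) = Re c *\<^sub>R \<psi> v + Im c *\<^sub>R (\<i> * \<psi> v)"
      by (simp add: add real imag)
    also have "\<dots> = c * \<psi> v"
      by (simp add: complex_eq_iff algebra_simps)
    finally show ?thesis .
  qed
  have bound: "cmod (\<psi> v) \<le> norm v" for v
  proof -
    obtain a where a: "cmod a = 1" "a * \<psi> v = cmod (\<psi> v)"
      using exists_unimodular_mult by blast
    then have "\<psi> (a *\<^sub>C v) = cmod (\<psi> v)" by (simp add: cscale)
    then have "cmod (\<psi> v) = r (a *\<^sub>C v)"
      unfolding \<psi>_def by (simp add: complex_eq_iff)
    also have "\<dots> \<le> norm v" using r(2)[of "a *\<^sub>C v"] a by (simp add: norm_scaleC)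
    finally show ?thesis .
  qed
  have "\<psi> y = norm y"
  proof -
    have Re: "Re (\<psi> y) = norm y" by (simp add: \<psi>_def r)
    then have "(norm y)\<^sup>2 + (Im (\<psi> y))\<^sup>2 \<le> (norm y)\<^sup>2"
      using power_mono[OF bound[of y], of 2] by (simp add: cmod_power2)
    then have "Im (\<psi> y) = 0" by simp
    with Re show ?thesis by (simp add: complex_eq_iff)
  qed
  moreover have "bounded_linear \<psi>"
    by (rule bounded_linear_intro[of _ 1]) (simp_all add: add real bound)
  ultimately show thesis using that cscale bound by blast
qed

section \<open>Bounded complex-linear operators\<close>

lemma bounded_linear_scaleC_left: "bounded_linear (\<lambda>c. c *\<^sub>C x)"
  for x :: "'a::complex_normed_vector"
  by (rule bounded_linear_intro[of _ "norm x"])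
     (simp_all add: scaleC_add_left scaleR_scaleC scaleC_scaleC scaleR_conv_of_real norm_scaleC)

lemma bounded_linear_scaleC_right: "bounded_linear (\<lambda>x :: 'a::complex_normed_vector. c *\<^sub>C x)"
  by (rule bounded_linear_intro[of _ "cmod c"])
     (simp_all add: scaleC_add_right scaleR_scaleC scaleC_scaleC norm_scaleC mult.commute)

lemma scaleC_of_real: "complex_of_real r *\<^sub>C x = r *\<^sub>R x"
  for x :: "'a::complex_normed_vector"
  by (simp add: scaleR_scaleC)

lemma clinear_opsD: "T \<in> clinear_ops \<Longrightarrow> blinfun_apply T (c *\<^sub>C x) = c *\<^sub>C blinfun_apply T x"
  by (simp add: clinear_ops_def)

lemma clinear_ops_scaleR: "T \<in> clinear_ops \<Longrightarrow> r *\<^sub>R T \<in> clinear_ops"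
  by (simp add: clinear_ops_def scaleR_blinfun.rep_eq scaleR_scaleC scaleC_scaleC mult.commute)

lemma norm_blinfun_le:
  fixes T :: "'a::real_normed_vector \<Rightarrow>\<^sub>L 'b::real_normed_vector"
  assumes "\<And>u. norm u \<le> 1 \<Longrightarrow> norm (blinfun_apply T u) \<le> b"
  shows "norm T \<le> b"
proof (rule norm_blinfun_bound)
  show "0 \<le> b" using assms[of 0] by simp
  fix u :: 'a
  show "norm (blinfun_apply T u) \<le> b * norm u"
  proof (cases "u = 0")
    case False
    then have "norm (blinfun_apply T ((1 / norm u) *\<^sub>R u)) \<le> b"
      by (intro assms) simp
    then show ?thesis using False by (simp add: blinfun.scaleR_right field_simps)
  qed simp
qed

lemma norm_blinfun_apply_le:
  assumes "norm T \<le> 1" shows "norm (blinfun_apply T u) \<le> norm u"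
  using norm_blinfun[of T u] mult_right_mono[OF assms, of "norm u"] by simp

lemma norm_normalized_diff:
  fixes x :: "'a::real_normed_vector"
  assumes "x \<noteq> 0" shows "norm ((1 / norm x) *\<^sub>R x - x) = \<bar>1 - norm x\<bar>"
proof -
  have "(1 / norm x) *\<^sub>R x - x = (1 / norm x - 1) *\<^sub>R x"
    by (simp add: algebra_simps)
  then have "norm ((1 / norm x) *\<^sub>R x - x) = \<bar>1 / norm x - 1\<bar> * \<bar>norm x\<bar>" by simp
  also have "\<dots> = \<bar>1 - norm x\<bar>"
    unfolding abs_mult[symmetric] using assms by (simp add: algebra_simps)
  finally show ?thesis .
qed

text \<open>
  Such a functional is the composition of \<^term>\<open>T\<close> with a norm-one functional on the
  range that norms \<^term>\<open>blinfun_apply T f\<close>. The bound by \<^term>\<open>norm (blinfun_apply T u)\<close> instead of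
  \<^term>\<open>norm u\<close> is what matters: where the functional is nearly 1, the operator is nearly norm-attaining.
\<close>

definition norming_for ::
    "('a::complex_normed_vector \<Rightarrow>\<^sub>L 'y::complex_normed_vector) \<Rightarrow> 'a \<Rightarrow> ('a \<Rightarrow> complex) \<Rightarrow> bool" where
  "norming_for T f \<phi> \<longleftrightarrow> bounded_linear \<phi> \<and> (\<forall>c u. \<phi> (c *\<^sub>C u) = c * \<phi> u) \<and>
     (\<forall>u. cmod (\<phi> u) \<le> norm (blinfun_apply T u)) \<and> \<phi> f = norm (blinfun_apply T f)"

lemma norming_for_exists:
  assumes "T \<in> clinear_ops" obtains \<phi> where "norming_for T f \<phi>"
proof -
  obtain \<psi> where \<psi>: "bounded_linear \<psi>" "\<And>c v. \<psi> (c *\<^sub>C v) = c * \<psi> v"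
    "\<And>v. cmod (\<psi> v) \<le> norm v" "\<psi> (blinfun_apply T f) = norm (blinfun_apply T f)"
    using norming_functional by metis
  have "norming_for T f (\<lambda>u. \<psi> (blinfun_apply T u))"
    unfolding norming_for_def using \<psi> assms
    by (auto simp: clinear_opsD intro: bounded_linear_compose blinfun.bounded_linear_right)
  then show thesis by (rule that)
qed

text \<open>
  The rank-one perturbation of Lindenstrauss: a near-maximizer of its norm must almost maximize
  \<^term>\<open>\<lambda>u. cmod (\<phi> u)\<close> as well, which ties it, up to a rotation, to \<^term>\<open>f\<close>.
\<close>

definition peaked ::
    "real \<Rightarrow> ('a::complex_normed_vector \<Rightarrow>\<^sub>L 'y::complex_normed_vector) \<Rightarrow> 'a \<Rightarrow> ('a \<Rightarrow> complex) \<Rightarrow> ('a \<Rightarrow>\<^sub>L 'y)" where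
  "peaked e T f \<phi> = Blinfun (\<lambda>u. blinfun_apply T u + e *\<^sub>R \<phi> u *\<^sub>C blinfun_apply T f)"

lemma peaked_apply:
  assumes "norming_for T f \<phi>"
  shows "blinfun_apply (peaked e T f \<phi>) u = blinfun_apply T u + e *\<^sub>R \<phi> u *\<^sub>C blinfun_apply T f"
proof -
  have "bounded_linear \<phi>" using assms by (simp add: norming_for_def)
  then have "bounded_linear (\<lambda>u. blinfun_apply T u + e *\<^sub>R \<phi> u *\<^sub>C blinfun_apply T f)"
    by (intro bounded_linear_add blinfun.bounded_linear_right bounded_linear_const_scaleR
        bounded_linear_compose[OF bounded_linear_scaleC_left])
  then show ?thesis by (simp add: peaked_def bounded_linear_Blinfun_apply)
qed

lemma peaked_clinear:
  assumes "norming_for T f \<phi>" "T \<in> clinear_ops"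
  shows "peaked e T f \<phi> \<in> clinear_ops"
proof -
  have "\<phi> (c *\<^sub>C u) = c * \<phi> u" for c u using assms(1) by (simp add: norming_for_def)
  then show ?thesis
    using assms(2) unfolding clinear_ops_def
    by (simp add: peaked_apply[OF assms(1)] scaleC_add_right scaleR_scaleC scaleC_scaleC mult_ac)
qed

section \<open>Uniform convexity of operators into complex uniformly convex spaces\<close>

text \<open>
  If \<^term>\<open>m\<close> and \<^term>\<open>k\<close> satisfy the pointwise bound, all the functions
  \<^term>\<open>m + w *\<^sub>C k\<close> with \<^term>\<open>w\<close> on the unit circle lie in the unit ball, so their images form a
  circle in the unit ball of the range and complex uniform convexity applies to its centre and radius.
\<close>

lemma operator_small_beside_near_maximizer:
  assumes "C_uniformly_convex TYPE('y::cbanach)" "\<epsilon> > 0"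
  obtains \<delta> where "\<delta> > 0"
    "\<And>(T :: 'l::topological_space c0 \<Rightarrow>\<^sub>L 'y) m k.
      \<lbrakk>T \<in> clinear_ops; norm T \<le> 1; \<And>x. cmod (apply_c0 m x) + cmod (apply_c0 k x) \<le> 1;
       norm (blinfun_apply T m) \<ge> 1 - \<delta>\<rbrakk> \<Longrightarrow> norm (blinfun_apply T k) \<le> \<epsilon>"
proof -
  obtain \<delta> where \<delta>: "\<delta> > 0" "\<And>y0 y1 :: 'y. (\<And>w. cmod w = 1 \<Longrightarrow> norm (y0 + w *\<^sub>C y1) \<le> 1) \<Longrightarrow>
      norm y1 > \<epsilon> \<Longrightarrow> norm y0 < 1 - \<delta>"
    using assms unfolding C_uniformly_convex_def by metis
  show thesis
  proof (rule that[OF \<delta>(1)])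
    fix T :: "'l c0 \<Rightarrow>\<^sub>L 'y" and m k
    assume T: "T \<in> clinear_ops" "norm T \<le> 1"
      and mk: "\<And>x. cmod (apply_c0 m x) + cmod (apply_c0 k x) \<le> 1"
      and large: "norm (blinfun_apply T m) \<ge> 1 - \<delta>"
    have "norm (blinfun_apply T m + w *\<^sub>C blinfun_apply T k) \<le> 1" if "cmod w = 1" for w
    proof -
      have "norm (m + w *\<^sub>C k) \<le> 1"
      proof (rule norm_c0_le)
        fix x
        show "cmod (apply_c0 (m + w *\<^sub>C k) x) \<le> 1"
          using norm_triangle_ineq[of "apply_c0 m x" "w * apply_c0 k x"] mk[of x] that
          by (simp add: apply_c0_simps norm_mult)
      qed
      then show ?thesis
        using norm_blinfun_apply_le[OF T(2), of "m + w *\<^sub>C k"] clinear_opsD[OF T(1)]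
        by (simp add: blinfun.add_right)
    qed
    then show "norm (blinfun_apply T k) \<le> \<epsilon>"
      using \<delta>(2)[of "blinfun_apply T m" "blinfun_apply T k"] large by force
  qed
qed

lemma cmod_parallelogram:
  "(cmod (a + b))\<^sup>2 + (cmod (a - b))\<^sup>2 = 2 * (cmod a)\<^sup>2 + 2 * (cmod b)\<^sup>2"
  unfolding cmod_power2 by (simp add: power2_eq_square algebra_simps)

lemma norm_midpoint_le:
  fixes a b :: complex
  assumes "cmod a \<le> 1" "cmod b \<le> 1"
  shows "cmod ((1/2) *\<^sub>R (a + b)) \<le> 1 - (cmod (a - b))\<^sup>2 / 8"
proof (rule power2_le_imp_le)
  have le: "cmod a ^ 2 \<le> 1" "cmod b ^ 2 \<le> 1"
    using assms by (simp_all add: power_le_one)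
  note par = cmod_parallelogram[of a b]
  have "(cmod ((1/2) *\<^sub>R (a + b)))\<^sup>2 = (cmod (a + b))\<^sup>2 / 4"
    by (simp add: power_divide power_mult_distrib)
  also have "\<dots> \<le> 1 - (cmod (a - b))\<^sup>2 / 4"
    using par le by simp
  also have "\<dots> \<le> (1 - (cmod (a - b))\<^sup>2 / 8)\<^sup>2"
    by (simp add: power2_diff power_divide)
  finally show "(cmod ((1/2) *\<^sub>R (a + b)))\<^sup>2 \<le> (1 - (cmod (a - b))\<^sup>2 / 8)\<^sup>2" .
  show "0 \<le> 1 - (cmod (a - b))\<^sup>2 / 8"
    using par le zero_le_power2[of "cmod (a + b)"] by linarith
qed

text \<open>
  An operator into a complex uniformly convex space behaves as if its range were uniformly convex
  in the ordinary sense, even though the range need not be. The reason is that the plane is uniformly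
  convex: where \<^term>\<open>f\<close> and \<^term>\<open>g\<close> differ by \<^term>\<open>d\<close>, their midpoint has modulus at most
  \<^term>\<open>1 - d\<^sup>2 / 8\<close>, which leaves room for a perturbation \<^term>\<open>k\<close> of modulus \<^term>\<open>d\<^sup>2 / 8\<close>. After
  \<^term>\<open>u\<close> is truncated at a small height, the remainder is a bounded multiple of such a perturbation.
\<close>

lemma operator_uniform_convexity:
  assumes cuc: "C_uniformly_convex TYPE('y::cbanach)" and \<epsilon>: "\<epsilon> > 0"
  obtains \<eta> where "\<eta> > 0"
    "\<And>(T :: 'l::topological_space c0 \<Rightarrow>\<^sub>L 'y) f g u.
      \<lbrakk>T \<in> clinear_ops; norm T \<le> 1; norm f \<le> 1; norm g \<le> 1;
       \<And>x. cmod (apply_c0 u x) \<le> cmod (apply_c0 f x - apply_c0 g x);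
       norm (blinfun_apply T (f + g)) \<ge> 2 - 2 * \<eta>\<rbrakk> \<Longrightarrow> norm (blinfun_apply T u) \<le> \<epsilon>"
proof -
  have "\<epsilon>\<^sup>2 / 8 > 0" using \<epsilon> by simp
  from operator_small_beside_near_maximizer[OF cuc this]
  obtain \<delta> where \<delta>: "\<delta> > 0" "\<And>(T :: 'l c0 \<Rightarrow>\<^sub>L 'y) m k.
      \<lbrakk>T \<in> clinear_ops; norm T \<le> 1; \<And>x. cmod (apply_c0 m x) + cmod (apply_c0 k x) \<le> 1;
       norm (blinfun_apply T m) \<ge> 1 - \<delta>\<rbrakk> \<Longrightarrow> norm (blinfun_apply T k) \<le> \<epsilon>\<^sup>2 / 8"
    by metis
  show thesis
  proof (rule that[OF \<delta>(1)])
    fix T :: "'l c0 \<Rightarrow>\<^sub>L 'y" and f g u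
    assume T: "T \<in> clinear_ops" "norm T \<le> 1" and fg: "norm f \<le> 1" "norm g \<le> 1"
      and u: "\<And>x. cmod (apply_c0 u x) \<le> cmod (apply_c0 f x - apply_c0 g x)"
      and large: "norm (blinfun_apply T (f + g)) \<ge> 2 - 2 * \<delta>"
    define c where "c = comp_c0 (radial_cut (\<epsilon> / 2)) u"
    have c: "apply_c0 c x = radial_cut (\<epsilon> / 2) (apply_c0 u x)" for x
      unfolding c_def using \<epsilon> by (simp add: apply_radial_cut_c0)
    \<comment> \<open>Truncating at height \<^term>\<open>h = \<epsilon> / 2\<close> and scaling by \<^term>\<open>h / 2\<close> yields the required bound, since
      \<^term>\<open>4 * h * (d - h) \<le> d\<^sup>2\<close>.\<close>
    define k where "k = (\<epsilon> / 4) *\<^sub>R (u - c)"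
    define m where "m = (1/2) *\<^sub>R (f + g)"
    have "norm (blinfun_apply T k) \<le> \<epsilon>\<^sup>2 / 8"
    proof (rule \<delta>(2)[OF T])
      fix x
      let ?d = "cmod (apply_c0 f x - apply_c0 g x)"
      have "cmod (apply_c0 k x) = \<epsilon> / 4 * max 0 (cmod (apply_c0 u x) - \<epsilon> / 2)"
        using \<epsilon> norm_diff_radial_cut[of "\<epsilon> / 2" "apply_c0 u x"]
        by (simp add: k_def apply_c0_simps c)
      also have "\<dots> \<le> \<epsilon> / 4 * max 0 (?d - \<epsilon> / 2)"
        using u[of x] \<epsilon> by (intro mult_left_mono) auto
      also have "\<dots> \<le> ?d\<^sup>2 / 8"
      proof (cases "?d \<le> \<epsilon> / 2")
        case False
        have "0 \<le> (?d - \<epsilon>)\<^sup>2" by simp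
        then show ?thesis using False by (simp add: power2_eq_square algebra_simps max_def)
      qed auto
      finally have "cmod (apply_c0 k x) \<le> ?d\<^sup>2 / 8" .
      moreover have "cmod (apply_c0 m x) \<le> 1 - ?d\<^sup>2 / 8"
        using norm_midpoint_le[OF cmod_apply_c0_le_one[OF fg(1)] cmod_apply_c0_le_one[OF fg(2)], of x x]
        by (simp add: m_def apply_c0_simps)
      ultimately show "cmod (apply_c0 m x) + cmod (apply_c0 k x) \<le> 1" by simp
    next
      show "1 - \<delta> \<le> norm (blinfun_apply T m)"
        using large by (simp add: m_def blinfun.scaleR_right)
    qed
    moreover have "norm (blinfun_apply T k) = \<epsilon> / 4 * norm (blinfun_apply T u - blinfun_apply T c)"
      using \<epsilon> by (simp add: k_def blinfun.scaleR_right blinfun.diff_right)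
    ultimately have "norm (blinfun_apply T u - blinfun_apply T c) \<le> \<epsilon> / 2"
      using \<epsilon> by (simp add: power2_eq_square field_simps)
    moreover have "norm c \<le> \<epsilon> / 2"
      by (rule norm_c0_le) (use \<epsilon> in \<open>simp add: c norm_radial_cut\<close>)
    then have "norm (blinfun_apply T c) \<le> \<epsilon> / 2"
      using norm_blinfun_apply_le[OF T(2), of c] by simp
    ultimately show "norm (blinfun_apply T u) \<le> \<epsilon>"
      using norm_triangle_sub[of "blinfun_apply T u" "blinfun_apply T c"] by simp
  qed
qed

section \<open>From norm-attaining to range strongly exposing\<close>

text \<open>
  The peaked operator \<^term>\<open>(1 / (1 + e)) *\<^sub>R peaked e T f \<phi>\<close> works. A norming sequence for it is also
  norming for \<^term>\<open>\<phi>\<close>; along a subsequence the values of \<^term>\<open>\<phi>\<close> converge to a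
  unimodular \<^term>\<open>\<theta>\<close>, so the sequence and \<^term>\<open>\<theta> *\<^sub>C f\<close> have midpoints that are almost norming for
  \<^term>\<open>T\<close>, and uniform convexity of \<^term>\<open>T\<close> makes their images converge together.
\<close>

lemma norm_attaining_near_RSE:
  fixes T :: "'l::topological_space c0 \<Rightarrow>\<^sub>L 'y::cbanach"
  assumes cuc: "C_uniformly_convex TYPE('y)"
    and T: "T \<in> clinear_ops" "norm T = 1" and f: "norm f = 1" "norm (blinfun_apply T f) = 1"
    and e: "e > 0"
  obtains S where "S \<in> RSE" "norm S = 1" "blinfun_apply S f = blinfun_apply T f" "norm (S - T) \<le> 2 * e"
proof -
  obtain \<phi> where \<phi>: "norming_for T f \<phi>" using norming_for_exists[OF T(1)] .
  have \<phi>_bl: "bounded_linear \<phi>" and \<phi>_le: "\<And>u. cmod (\<phi> u) \<le> norm (blinfun_apply T u)" and \<phi>_f: "\<phi> f = 1"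
    and \<phi>_C: "\<And>c u. \<phi> (c *\<^sub>C u) = c * \<phi> u"
    using \<phi> f by (auto simp: norming_for_def)
  interpret \<phi>: bounded_linear \<phi> by fact
  define S where "S = (1 / (1 + e)) *\<^sub>R peaked e T f \<phi>"
  have S: "blinfun_apply S u = (1 / (1 + e)) *\<^sub>R (blinfun_apply T u + e *\<^sub>R \<phi> u *\<^sub>C blinfun_apply T f)" for u
    by (simp add: S_def scaleR_blinfun.rep_eq peaked_apply[OF \<phi>])
  have bound: "(1 + e) * norm (blinfun_apply S u) \<le> norm (blinfun_apply T u) + e * cmod (\<phi> u)" for u
    using e norm_triangle_ineq[of "blinfun_apply T u" "e *\<^sub>R \<phi> u *\<^sub>C blinfun_apply T f"]
    by (simp add: S norm_scaleC f)
  have T_le: "norm (blinfun_apply T u) \<le> norm u" for u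
    using norm_blinfun_apply_le[of T u] T by simp
  have Sf: "blinfun_apply S f = blinfun_apply T f"
  proof -
    have "blinfun_apply S f = (1 / (1 + e)) *\<^sub>R ((1 + e) *\<^sub>R blinfun_apply T f)"
      by (simp add: S \<phi>_f scaleR_add_left)
    then show ?thesis using e by simp
  qed
  have norm_S: "norm S = 1"
  proof (rule antisym)
    show "norm S \<le> 1"
    proof (rule norm_blinfun_le)
      fix u :: "'l c0" assume u: "norm u \<le> 1"
      have "cmod (\<phi> u) \<le> 1" "norm (blinfun_apply T u) \<le> 1"
        using \<phi>_le[of u] T_le[of u] u by auto
      then have "(1 + e) * norm (blinfun_apply S u) \<le> 1 + e"
        using bound[of u] mult_left_mono[of "cmod (\<phi> u)" 1 e] e by linarith
      then show "norm (blinfun_apply S u) \<le> 1"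
        using e mult_le_cancel_left_pos[of "1 + e" _ 1] by simp
    qed
    show "1 \<le> norm S" using norm_blinfun[of S f] f Sf by simp
  qed
  have "norm (S - T) \<le> 2 * e"
  proof (rule norm_blinfun_le)
    fix u :: "'l c0" assume u: "norm u \<le> 1"
    have "(1 + e) *\<^sub>R (blinfun_apply S u - blinfun_apply T u)
        = e *\<^sub>R (\<phi> u *\<^sub>C blinfun_apply T f - blinfun_apply T u)"
      using e by (simp add: S scaleR_diff_right scaleR_add_left)
    then have "(1 + e) * norm (blinfun_apply S u - blinfun_apply T u)
        = e * norm (\<phi> u *\<^sub>C blinfun_apply T f - blinfun_apply T u)"
      using e by (metis abs_of_nonneg add_nonneg_nonneg less_imp_le norm_scaleR zero_le_one)
    also have "\<dots> \<le> e * 2"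
      using e \<phi>_le[of u] T_le[of u] u f
        norm_triangle_ineq4[of "\<phi> u *\<^sub>C blinfun_apply T f" "blinfun_apply T u"]
      by (intro mult_left_mono) (auto simp: norm_scaleC)
    finally have *: "(1 + e) * norm (blinfun_apply S u - blinfun_apply T u) \<le> e * 2" .
    have "1 * norm (blinfun_apply S u - blinfun_apply T u)
        \<le> (1 + e) * norm (blinfun_apply S u - blinfun_apply T u)"
      using e by (intro mult_right_mono) auto
    with * show "norm (blinfun_apply (S - T) u) \<le> 2 * e"
      by (simp add: blinfun.diff_left)
  qed
  moreover have "S \<in> RSE"
    unfolding RSE_def
  proof (intro CollectI conjI exI[of _ f] allI impI)
    show "S \<in> clinear_ops"
      unfolding S_def by (intro clinear_ops_scaleR peaked_clinear[OF \<phi> T(1)])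
    show "norm f = 1" by fact
    fix x :: "nat \<Rightarrow> 'l c0"
    assume x: "\<forall>n. norm (x n) \<le> 1"
      and "(\<lambda>n. norm (blinfun_apply S (x n))) \<longlonglongrightarrow> norm S"
    then have lim: "(\<lambda>n. norm (blinfun_apply S (x n))) \<longlonglongrightarrow> 1" by (simp add: norm_S)
    have \<phi>_le1: "cmod (\<phi> (x n)) \<le> 1" for n
      using \<phi>_le[of "x n"] T_le[of "x n"] x by (meson order_trans)
    have "(\<lambda>n. cmod (\<phi> (x n))) \<longlonglongrightarrow> 1"
    proof (rule tendsto_sandwich[of "\<lambda>n. ((1 + e) * norm (blinfun_apply S (x n)) - 1) / e" _ _ "\<lambda>_. 1"])
      show "\<forall>\<^sub>F n in sequentially. ((1 + e) * norm (blinfun_apply S (x n)) - 1) / e \<le> cmod (\<phi> (x n))"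
      proof (rule always_eventually, rule allI)
        fix n
        have "norm (blinfun_apply T (x n)) \<le> 1" using T_le[of "x n"] x by (meson order_trans)
        then show "((1 + e) * norm (blinfun_apply S (x n)) - 1) / e \<le> cmod (\<phi> (x n))"
          using bound[of "x n"] e by (simp add: divide_le_eq mult.commute)
      qed
      have "(\<lambda>n. ((1 + e) * norm (blinfun_apply S (x n)) - 1) / e) \<longlonglongrightarrow> ((1 + e) * 1 - 1) / e"
        using e by (intro tendsto_intros lim) auto
      then show "(\<lambda>n. ((1 + e) * norm (blinfun_apply S (x n)) - 1) / e) \<longlonglongrightarrow> 1" using e by simp
    qed (use \<phi>_le1 in auto)
    moreover obtain \<theta> \<sigma> where \<sigma>: "strict_mono \<sigma>" "(\<lambda>n. \<phi> (x (\<sigma> n))) \<longlonglongrightarrow> \<theta>"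
    proof -
      have "\<exists>l\<in>cball 0 1. \<exists>r. strict_mono r \<and> ((\<lambda>n. \<phi> (x n)) \<circ> r) \<longlonglongrightarrow> l"
        using compact_cball[of "0::complex" 1] \<phi>_le1 unfolding compact_def by simp
      then show thesis using that by (auto simp: o_def)
    qed
    ultimately have "(\<lambda>n. cmod (\<phi> (x (\<sigma> n)))) \<longlonglongrightarrow> 1"
      using LIMSEQ_subseq_LIMSEQ[of "\<lambda>n. cmod (\<phi> (x n))" 1 \<sigma>] by (simp add: o_def)
    then have "cmod \<theta> = 1"
      using LIMSEQ_unique[OF tendsto_norm[OF \<sigma>(2)]] by simp
    have "(\<lambda>n. blinfun_apply T (x (\<sigma> n))) \<longlonglongrightarrow> \<theta> *\<^sub>C blinfun_apply T f"
    proof (rule tendstoI)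
      fix r :: real assume "r > 0"
      then have "r / 2 > 0" by simp
      from operator_uniform_convexity[OF cuc this]
      obtain \<eta> where \<eta>: "\<eta> > 0" "\<And>(T :: 'l c0 \<Rightarrow>\<^sub>L 'y) f g u.
          \<lbrakk>T \<in> clinear_ops; norm T \<le> 1; norm f \<le> 1; norm g \<le> 1;
           \<And>x. cmod (apply_c0 u x) \<le> cmod (apply_c0 f x - apply_c0 g x);
           norm (blinfun_apply T (f + g)) \<ge> 2 - 2 * \<eta>\<rbrakk> \<Longrightarrow> norm (blinfun_apply T u) \<le> r / 2"
        by metis
      have "\<forall>\<^sub>F n in sequentially. dist (\<phi> (x (\<sigma> n))) \<theta> < 2 * \<eta>"
        using \<sigma>(2) \<eta>(1) by (intro tendstoD) auto
      then show "\<forall>\<^sub>F n in sequentially. dist (blinfun_apply T (x (\<sigma> n))) (\<theta> *\<^sub>C blinfun_apply T f) < r"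
      proof eventually_elim
        case (elim n)
        have "norm (blinfun_apply T (x (\<sigma> n) - \<theta> *\<^sub>C f)) \<le> r / 2"
        proof (rule \<eta>(2)[OF T(1), of "x (\<sigma> n)" "\<theta> *\<^sub>C f"])
          have "\<phi> (x (\<sigma> n) + \<theta> *\<^sub>C f) = 2 * \<theta> + (\<phi> (x (\<sigma> n)) - \<theta>)"
            by (simp add: \<phi>.add \<phi>_C \<phi>_f)
          then have "cmod (\<phi> (x (\<sigma> n) + \<theta> *\<^sub>C f)) \<ge> cmod (2 * \<theta>) - cmod (\<phi> (x (\<sigma> n)) - \<theta>)"
            by (metis norm_diff_ineq)
          then show "2 - 2 * \<eta> \<le> norm (blinfun_apply T (x (\<sigma> n) + \<theta> *\<^sub>C f))"
            using \<phi>_le[of "x (\<sigma> n) + \<theta> *\<^sub>C f"] elim \<open>cmod \<theta> = 1\<close> by (simp add: dist_norm norm_mult)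
        qed (use T x f \<open>cmod \<theta> = 1\<close> in \<open>auto simp: norm_scaleC apply_c0_simps\<close>)
        then show ?case
          using \<open>r > 0\<close> by (simp add: dist_norm blinfun.diff_right clinear_opsD[OF T(1)])
      qed
    qed
    then have "(\<lambda>n. blinfun_apply S (x (\<sigma> n))) \<longlonglongrightarrow>
        (1 / (1 + e)) *\<^sub>R (\<theta> *\<^sub>C blinfun_apply T f + e *\<^sub>R \<theta> *\<^sub>C blinfun_apply T f)"
      unfolding S
      by (intro tendsto_intros bounded_linear.tendsto[OF bounded_linear_scaleC_left] \<sigma>(2))
    also have "(1 / (1 + e)) *\<^sub>R (\<theta> *\<^sub>C blinfun_apply T f + e *\<^sub>R \<theta> *\<^sub>C blinfun_apply T f)
        = (1 / (1 + e)) *\<^sub>R ((1 + e) *\<^sub>R \<theta> *\<^sub>C blinfun_apply T f)"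
      by (simp add: scaleR_add_left)
    also have "\<dots> = \<theta> *\<^sub>C blinfun_apply S f" using e by (simp add: Sf)
    finally show "\<exists>\<sigma> \<theta>. strict_mono \<sigma> \<and> cmod \<theta> = 1 \<and>
        (\<lambda>n. blinfun_apply S (x (\<sigma> n))) \<longlonglongrightarrow> \<theta> *\<^sub>C blinfun_apply S f"
      using \<sigma>(1) \<open>cmod \<theta> = 1\<close> by blast
  qed
  ultimately show thesis using that norm_S Sf by blast
qed

section \<open>Improving an operator that almost attains its norm\<close>

lemma near_norm_point:
  fixes T :: "'a::real_normed_vector \<Rightarrow>\<^sub>L 'b::real_normed_vector"
  assumes "\<eta> > 0"
  obtains u where "norm u \<le> 1" "norm (blinfun_apply T u) \<ge> norm T - \<eta>"
proof -
  have "\<exists>u. norm u \<le> 1 \<and> norm (blinfun_apply T u) \<ge> norm T - \<eta>"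
  proof (rule ccontr)
    assume neg: "\<not> ?thesis"
    have "norm T \<le> norm T - \<eta>"
      by (rule norm_blinfun_le) (use neg in force)
    then show False using assms by simp
  qed
  then show thesis using that by blast
qed

text \<open>
  In terms of a representing measure: \<^term>\<open>T\<close> lives on the compact set where \<^term>\<open>f\<close> is
  unimodular. The algebraic form is stable under limits and under multiplication operators.
\<close>

definition carried_by :: "('l::topological_space c0 \<Rightarrow>\<^sub>L 'y::cbanach) \<Rightarrow> 'l c0 \<Rightarrow> bool" where
  "carried_by T f \<longleftrightarrow> (\<forall>u. blinfun_apply T (f * cnj_c0 f * u) = blinfun_apply T u)"

lemma carried_byD: "carried_by T f \<Longrightarrow> blinfun_apply T (f * cnj_c0 f * u) = blinfun_apply T u"
  by (simp add: carried_by_def)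

lemma carried_by_scaleR: "carried_by T f \<Longrightarrow> carried_by (r *\<^sub>R T) f"
  by (simp add: carried_by_def scaleR_blinfun.rep_eq)

lemma norm_mult_le_one: "norm f \<le> 1 \<Longrightarrow> norm g \<le> 1 \<Longrightarrow> norm (f * g) \<le> 1"
  for f g :: "'a::real_normed_algebra"
  using norm_mult_ineq[of f g] mult_le_one[of "norm f" "norm g"] by simp

lemma norm_cnj_c0_le: "norm f \<le> 1 \<Longrightarrow> norm (cnj_c0 f) \<le> 1"
  by (rule norm_c0_le) (simp add: apply_c0_simps cmod_apply_c0_le_one)

text \<open>
  Let \<^term>\<open>R\<close> be the peaked operator and \<^term>\<open>g\<close> a function at which it almost attains its norm, as
  closely as desired. Then \<^term>\<open>g\<close> is close to \<^term>\<open>f\<close> only as far as \<^term>\<open>T\<close> can see, not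
  in the supremum norm, so \<^term>\<open>f\<close> cannot be replaced by \<^term>\<open>g\<close>. Instead the operator is
  composed with multiplication by \<^term>\<open>g * cnj_c0 f\<close>. This contraction sends \<^term>\<open>f\<close> to
  \<^term>\<open>g\<close> on the set where \<^term>\<open>f\<close> is unimodular, so the new operator takes at \<^term>\<open>f\<close> the value of
  \<^term>\<open>R\<close> at \<^term>\<open>g\<close>; and it moves \<^term>\<open>T\<close> only a little, because on that set it differs from the
  identity by multiplication with \<^term>\<open>(g - f) * cnj_c0 f\<close>, which is dominated by \<^term>\<open>f - g\<close>. The function \<^term>\<open>f\<close> is the same
  before and after the step, and \<^term>\<open>\<eta>\<close> depends only on \<^term>\<open>\<epsilon>\<close>, so the step can be iterated.
\<close>

lemma improvement_step:
  assumes cuc: "C_uniformly_convex TYPE('y::cbanach)" and \<epsilon>: "\<epsilon> > 0"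
  obtains \<eta> where "\<eta> > 0"
    "\<And>(T :: 'l::topological_space c0 \<Rightarrow>\<^sub>L 'y) f \<eta>'.
      \<lbrakk>T \<in> clinear_ops; norm T = 1; norm f \<le> 1; carried_by T f;
       norm (blinfun_apply T f) \<ge> 1 - \<eta>; \<eta>' > 0\<rbrakk> \<Longrightarrow>
      \<exists>S \<in> clinear_ops. norm S = 1 \<and> carried_by S f \<and> norm (blinfun_apply S f) \<ge> 1 - \<eta>' \<and>
        norm (S - T) \<le> \<epsilon>"
proof -
  \<comment> \<open>The new operator is within \<^term>\<open>3 * e\<close> of \<^term>\<open>T\<close>, and normalizing it costs \<^term>\<open>3 * e\<close> again; with
    \<^term>\<open>3 * e \<le> 1/2\<close> its norm stays away from 0.\<close>
  define e where "e = min (1/6) (\<epsilon> / 6)"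
  have e: "e > 0" "e \<le> 1/6" "6 * e \<le> \<epsilon>" using \<epsilon> by (auto simp: e_def)
  from operator_uniform_convexity[OF cuc e(1)]
  obtain \<eta>0 where \<eta>0: "\<eta>0 > 0" "\<And>(T :: 'l c0 \<Rightarrow>\<^sub>L 'y) f g u.
      \<lbrakk>T \<in> clinear_ops; norm T \<le> 1; norm f \<le> 1; norm g \<le> 1;
       \<And>x. cmod (apply_c0 u x) \<le> cmod (apply_c0 f x - apply_c0 g x);
       norm (blinfun_apply T (f + g)) \<ge> 2 - 2 * \<eta>0\<rbrakk> \<Longrightarrow> norm (blinfun_apply T u) \<le> e"
    by metis
  define \<eta> where "\<eta> = e * \<eta>0 / 4"
  have \<eta>: "\<eta> > 0" "4 * \<eta> = e * \<eta>0" using e \<eta>0(1) by (auto simp: \<eta>_def)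
  show thesis
  proof (rule that[OF \<eta>(1)])
    fix T :: "'l c0 \<Rightarrow>\<^sub>L 'y" and f \<eta>'
    assume T: "T \<in> clinear_ops" "norm T = 1" and f: "norm f \<le> 1" and carried: "carried_by T f"
      and large: "norm (blinfun_apply T f) \<ge> 1 - \<eta>" and \<eta>': "\<eta>' > (0::real)"
    define t where "t = norm (blinfun_apply T f)"
    have T_le: "norm (blinfun_apply T u) \<le> norm u" for u
      using norm_blinfun_apply_le[of T u] T by simp
    have t: "1 - \<eta> \<le> t" "t \<le> 1" "t \<ge> 0"
      using large T_le[of f] f by (auto simp: t_def)
    obtain \<phi> where \<phi>: "norming_for T f \<phi>" using norming_for_exists[OF T(1)] .
    then have \<phi>_bl: "bounded_linear \<phi>" and \<phi>_le: "\<And>u. cmod (\<phi> u) \<le> norm (blinfun_apply T u)"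
      and \<phi>_f: "\<phi> f = t" and \<phi>_C: "\<And>c u. \<phi> (c *\<^sub>C u) = c * \<phi> u"
      by (auto simp: norming_for_def t_def)
    interpret \<phi>: bounded_linear \<phi> by fact
    define R where "R = peaked e T f \<phi>"
    have R: "blinfun_apply R u = blinfun_apply T u + e *\<^sub>R \<phi> u *\<^sub>C blinfun_apply T f" for u
      by (simp add: R_def peaked_apply[OF \<phi>])
    have R_clin: "R \<in> clinear_ops" unfolding R_def by (rule peaked_clinear[OF \<phi> T(1)])
    have R_le: "norm (blinfun_apply R u) \<le> norm (blinfun_apply T u) + e * cmod (\<phi> u)" for u
    proof -
      have "norm (e *\<^sub>R \<phi> u *\<^sub>C blinfun_apply T f) \<le> e * cmod (\<phi> u)"
        using e t mult_left_mono[of t 1 "e * cmod (\<phi> u)"] by (simp add: norm_scaleC t_def mult.assoc)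
      then show ?thesis unfolding R by (intro norm_triangle_le) simp
    qed
    \<comment> \<open>The factor 2 absorbs the division by the norm of the new operator, which is at least 1/2.\<close>
    define \<eta>'' where "\<eta>'' = min \<eta> (\<eta>' / 2)"
    have \<eta>'': "\<eta>'' > 0" "\<eta>'' \<le> \<eta>" "2 * \<eta>'' \<le> \<eta>'" using \<eta> \<eta>' by (auto simp: \<eta>''_def)
    obtain g0 where g0: "norm g0 \<le> 1" "norm (blinfun_apply R g0) \<ge> norm R - \<eta>''"
      using near_norm_point[OF \<eta>''(1)] .
    obtain a where a: "cmod a = 1" "a * \<phi> g0 = cmod (\<phi> g0)"
      using exists_unimodular_mult by blast
    \<comment> \<open>The rotation makes the value of \<^term>\<open>\<phi>\<close> nonnegative, so that it adds up with the one at \<^term>\<open>f\<close>.\<close>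
    define g where "g = a *\<^sub>C g0"
    have g: "norm g \<le> 1" "norm (blinfun_apply R g) \<ge> norm R - \<eta>''"
      using g0 a(1) by (simp_all add: g_def norm_scaleC clinear_opsD[OF R_clin])
    define s where "s = cmod (\<phi> g0)"
    have \<phi>_g: "\<phi> g = complex_of_real s" using a(2) by (simp add: g_def \<phi>_C s_def)
    have "s \<ge> 0" by (simp add: s_def)
    \<comment> \<open>Compare the values of \<^term>\<open>R\<close> at \<^term>\<open>f\<close> and at \<^term>\<open>g\<close>: the first is almost \<^term>\<open>1 + e\<close>,
      the second is at most \<^term>\<open>1 + e * s\<close> and almost the norm.\<close>
    have s_large: "e * s \<ge> e - 4 * \<eta>"
    proof -
      have "blinfun_apply R f = (1 + e * t) *\<^sub>R blinfun_apply T f"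
        by (simp add: R \<phi>_f scaleC_of_real scaleR_add_left)
      then have "norm (blinfun_apply R f) = (1 + e * t) * t"
        using e t by (simp add: t_def)
      then have "norm R \<ge> t + e * (t * t)"
        using norm_blinfun[of R f] mult_left_mono[OF f, of "norm R"] by (simp add: algebra_simps)
      moreover have "norm (blinfun_apply R g) \<le> 1 + e * s"
        using R_le[of g] T_le[of g] g(1) \<open>s \<ge> 0\<close> by (simp add: \<phi>_g)
      moreover have "e * (t * t) \<ge> 2 * (e * t) - e"
      proof -
        have "0 \<le> e * (t - 1)\<^sup>2" using e by simp
        then show ?thesis by (simp add: power2_eq_square algebra_simps)
      qed
      moreover have "e * t \<ge> e - e * \<eta>"
        using t e mult_left_mono[of "1 - \<eta>" t e] by (simp add: right_diff_distrib)
      moreover have "e * \<eta> \<le> \<eta>" using e \<eta> by simp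
      ultimately show ?thesis using g(2) \<eta>'' t by linarith
    qed
    have s_large': "s \<ge> 1 - \<eta>0"
    proof -
      have "e * s \<ge> e * (1 - \<eta>0)" using s_large \<eta>(2) by (simp add: algebra_simps)
      then show ?thesis using e by simp
    qed
    have "\<eta> \<le> \<eta>0"
      using mult_right_mono[of e 1 \<eta>0] e \<eta>0(1) by (simp add: \<eta>_def)
    have close: "norm (blinfun_apply T u) \<le> e"
      if "\<And>x. cmod (apply_c0 u x) \<le> cmod (apply_c0 f x - apply_c0 g x)" for u
    proof (rule \<eta>0(2)[OF T(1) _ f g(1) that])
      have "cmod (\<phi> (f + g)) = t + s"
        using t \<open>s \<ge> 0\<close> by (simp add: \<phi>.add \<phi>_f \<phi>_g norm_of_real flip: of_real_add)
      then show "2 - 2 * \<eta>0 \<le> norm (blinfun_apply T (f + g))"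
        using \<phi>_le[of "f + g"] t s_large' \<open>\<eta> \<le> \<eta>0\<close> by simp
    qed (use T in auto)
    define S0 where "S0 = R o\<^sub>L Blinfun ((*) (g * cnj_c0 f))"
    have S0: "blinfun_apply S0 u = blinfun_apply R (g * cnj_c0 f * u)" for u
      by (simp add: S0_def bounded_linear_Blinfun_apply bounded_linear_mult_right)
    have S0_clin: "S0 \<in> clinear_ops"
      using R_clin by (simp add: clinear_ops_def S0 scaleC_mult_c0)
    have R_carried: "blinfun_apply R (f * cnj_c0 f * u) = blinfun_apply R u" for u
    proof -
      have "blinfun_apply T (f * cnj_c0 f * u - u) = 0"
        by (simp add: blinfun.diff_right carried_byD[OF carried])
      then have "\<phi> (f * cnj_c0 f * u) = \<phi> u"
        using \<phi>_le[of "f * cnj_c0 f * u - u"] by (simp add: \<phi>.diff)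
      then show ?thesis by (simp add: R carried_byD[OF carried])
    qed
    have S0_carried: "carried_by S0 f"
      unfolding carried_by_def
    proof
      fix u
      have "g * cnj_c0 f * (f * cnj_c0 f * u) = f * cnj_c0 f * (g * cnj_c0 f * u)"
        by (rule c0_eqI) (simp add: apply_c0_simps)
      then show "blinfun_apply S0 (f * cnj_c0 f * u) = blinfun_apply S0 u"
        by (simp add: S0 R_carried)
    qed
    have S0f: "blinfun_apply S0 f = blinfun_apply R g"
    proof -
      have "g * cnj_c0 f * f = f * cnj_c0 f * g"
        by (rule c0_eqI) (simp add: apply_c0_simps)
      then show ?thesis by (simp add: S0 R_carried)
    qed
    have S0_le: "norm S0 \<le> norm R"
    proof (rule norm_blinfun_le)
      fix u :: "'l c0" assume "norm u \<le> 1"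
      then have "norm (g * cnj_c0 f * u) \<le> 1"
        using f g by (intro norm_mult_le_one norm_cnj_c0_le)
      then show "norm (blinfun_apply S0 u) \<le> norm R"
        unfolding S0 using norm_blinfun[of R "g * cnj_c0 f * u"]
          mult_left_mono[of "norm (g * cnj_c0 f * u)" 1 "norm R"] by simp
    qed
    have S0T: "norm (S0 - T) \<le> 3 * e"
    proof (rule norm_blinfun_le)
      fix u :: "'l c0" assume u: "norm u \<le> 1"
      define v where "v = (g - f) * cnj_c0 f * u"
      have "norm (cnj_c0 f * u) \<le> 1" using f u by (intro norm_mult_le_one norm_cnj_c0_le)
      then have "cmod (apply_c0 (cnj_c0 f * u) x) \<le> 1" for x by (rule cmod_apply_c0_le_one)
      then have "cmod (apply_c0 v x) \<le> cmod (apply_c0 f x - apply_c0 g x)" for x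
        using mult_left_mono[of _ 1 "cmod (apply_c0 f x - apply_c0 g x)"]
        by (simp add: v_def apply_c0_simps norm_mult mult.assoc norm_minus_commute)
      then have "norm (blinfun_apply T v) \<le> e" by (rule close)
      moreover have "norm (blinfun_apply R v) \<le> norm (blinfun_apply T v) + e * norm (blinfun_apply T v)"
        using R_le[of v] mult_left_mono[OF \<phi>_le[of v] less_imp_le[OF e(1)]] by linarith
      moreover have "e * norm (blinfun_apply T v) \<le> 1 * norm (blinfun_apply T v)"
        using e by (intro mult_right_mono) auto
      ultimately have "norm (blinfun_apply R v) \<le> 2 * e" by simp
      moreover have "norm (blinfun_apply R u - blinfun_apply T u) \<le> e"
      proof -
        have "cmod (\<phi> u) \<le> 1" using \<phi>_le[of u] T_le[of u] u by simp
        then have "cmod (\<phi> u) * t \<le> 1" using t by (intro mult_le_one) auto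
        then show ?thesis using e by (simp add: R norm_scaleC t_def)
      qed
      moreover have "blinfun_apply (S0 - T) u = blinfun_apply R v + (blinfun_apply R u - blinfun_apply T u)"
      proof -
        have "blinfun_apply R v = blinfun_apply S0 u - blinfun_apply R (f * cnj_c0 f * u)"
          by (simp add: v_def S0 left_diff_distrib blinfun.diff_right)
        then show ?thesis by (simp add: R_carried blinfun.diff_left)
      qed
      ultimately show "norm (blinfun_apply (S0 - T) u) \<le> 3 * e"
        using norm_triangle_ineq[of "blinfun_apply R v" "blinfun_apply R u - blinfun_apply T u"] by simp
    qed
    have norm_S0: "\<bar>1 - norm S0\<bar> \<le> 3 * e"
      using norm_triangle_ineq3[of S0 T] S0T T by simp
    then have half: "norm S0 \<ge> 1/2" using e by simp
    then have "S0 \<noteq> 0" by auto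
    define S where "S = (1 / norm S0) *\<^sub>R S0"
    have "norm (blinfun_apply S f) \<ge> 1 - \<eta>'"
    proof -
      have "norm (blinfun_apply S0 f) \<ge> norm S0 - \<eta>''" using g(2) S0_le by (simp add: S0f)
      moreover have "\<eta>'' \<le> \<eta>' * norm S0"
        using \<eta>''(3) mult_left_mono[OF half less_imp_le[OF \<eta>']] by linarith
      ultimately show ?thesis
        using \<open>S0 \<noteq> 0\<close> by (simp add: S_def scaleR_blinfun.rep_eq field_simps)
    qed
    moreover have "norm (S - T) \<le> \<epsilon>"
      using norm_triangle_ineq[of "S - S0" "S0 - T"] norm_normalized_diff[OF \<open>S0 \<noteq> 0\<close>] norm_S0 S0T e
      by (simp add: S_def)
    ultimately show "\<exists>S \<in> clinear_ops. norm S = 1 \<and> carried_by S f \<and>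
        norm (blinfun_apply S f) \<ge> 1 - \<eta>' \<and> norm (S - T) \<le> \<epsilon>"
      using \<open>S0 \<noteq> 0\<close> S0_clin S0_carried
      by (intro bexI[of _ S]) (auto simp: S_def clinear_ops_scaleR carried_by_scaleR)
  qed
qed

section \<open>Attaining the norm in the limit\<close>

text \<open>
  A defect that can be made arbitrarily small at a cost depending only on its current size can be
  removed: the costs of the successive steps are prescribed as a geometric series, and each step makes
  the defect small enough to pay for the next one.
\<close>

lemma exact_zero_by_iteration:
  fixes A :: "'a::banach set" and d :: "'a \<Rightarrow> real"
  assumes A: "closed A" and d: "continuous_on A d" "\<And>x. x \<in> A \<Longrightarrow> d x \<ge> 0"
    and \<eta>: "\<And>e. e > 0 \<Longrightarrow> \<eta> e > 0"
    and step: "\<And>e x \<eta>'. \<lbrakk>e > 0; x \<in> A; d x \<le> \<eta> e; \<eta>' > 0\<rbrakk> \<Longrightarrow> \<exists>y\<in>A. d y \<le> \<eta>' \<and> norm (y - x) \<le> e"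
    and e: "e > 0" and x: "x \<in> A" "d x \<le> \<eta> (e / 2)"
  obtains y where "y \<in> A" "d y = 0" "norm (y - x) \<le> e"
proof -
  define r where "r n = e * (1/2) ^ Suc n" for n
  have r: "r n > 0" for n using e by (simp add: r_def)
  define P where "P n y \<longleftrightarrow> y \<in> A \<and> d y \<le> \<eta> (r n) \<and> (n = 0 \<longrightarrow> y = x)" for n y
  define Q where "Q n y z \<longleftrightarrow> norm (z - y) \<le> r n \<and> d z \<le> (1/2) ^ n" for n y z
  have "\<exists>s. \<forall>n. P n (s n) \<and> Q n (s n) (s (Suc n))"
  proof (rule dependent_nat_choice)
    show "\<exists>y. P 0 y" using x by (auto simp: P_def r_def)
    fix y n assume "P n y"
    moreover have "min (\<eta> (r (Suc n))) ((1/2) ^ n) > 0" using \<eta>[OF r] by simp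
    ultimately obtain z where "z \<in> A" "d z \<le> min (\<eta> (r (Suc n))) ((1/2) ^ n)" "norm (z - y) \<le> r n"
      using step[OF r[of n], of y] unfolding P_def by blast
    then show "\<exists>z. P (Suc n) z \<and> Q n y z"
      unfolding P_def Q_def by (intro exI[of _ z]) simp
  qed
  then obtain s where "\<And>n. P n (s n)" "\<And>n. Q n (s n) (s (Suc n))"
    by blast
  then have s: "\<And>n. s n \<in> A" "s 0 = x" "\<And>n. norm (s (Suc n) - s n) \<le> r n"
    "\<And>n. d (s (Suc n)) \<le> (1/2) ^ n"
    by (simp_all add: P_def Q_def)
  have r_sums: "r sums e"
    unfolding r_def using sums_mult[OF power_half_series, of e] by simp
  have "summable (\<lambda>n. s (Suc n) - s n)"
    by (rule summable_comparison_test'[OF sums_summable[OF r_sums]]) (rule s(3))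
  then obtain l where "(\<lambda>n. \<Sum>i<n. s (Suc i) - s i) \<longlonglongrightarrow> l"
    by (auto simp: summable_def sums_def)
  then have "(\<lambda>n. s n - x) \<longlonglongrightarrow> l" by (simp add: sum_lessThan_telescope s(2))
  from tendsto_add[OF this tendsto_const[of x]]
  have lim: "s \<longlonglongrightarrow> l + x" by simp
  show thesis
  proof
    show mem: "l + x \<in> A" using closed_sequentially[OF A _ lim] s(1) by blast
    have "(\<lambda>n. d (s n)) \<longlonglongrightarrow> d (l + x)"
      using d(1) lim s(1) mem by (intro continuous_on_tendsto_compose[OF d(1)]) auto
    then have "(\<lambda>n. d (s (Suc n))) \<longlonglongrightarrow> d (l + x)" by (rule LIMSEQ_Suc)
    moreover have "(\<lambda>n. (1/2::real) ^ n) \<longlonglongrightarrow> 0" by (rule LIMSEQ_realpow_zero) auto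
    ultimately have "d (l + x) \<le> 0" by (rule LIMSEQ_le) (use s(4) in auto)
    then show "d (l + x) = 0" using d(2)[OF mem] by simp
    have "norm (s n - x) \<le> e" for n
    proof -
      have "norm (s n - x) = norm (\<Sum>i<n. s (Suc i) - s i)"
        by (simp add: sum_lessThan_telescope s(2))
      also have "\<dots> \<le> (\<Sum>i<n. r i)" by (rule order_trans[OF norm_sum sum_mono]) (rule s(3))
      also have "\<dots> \<le> e"
        using sum_le_suminf[OF sums_summable[OF r_sums], of "{..<n}"] r sums_unique[OF r_sums]
        by (simp add: less_imp_le)
      finally show ?thesis .
    qed
    then show "norm (l + x - x) \<le> e"
      using LIMSEQ_le_const2[OF tendsto_norm[OF tendsto_diff[OF lim tendsto_const[of x]]]] by blast
  qed
qed

text \<open>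
  The iteration runs in the closed set of norm-one complex-linear operators carried by
  \<^term>\<open>f\<close>, with the defect \<^term>\<open>\<lambda>S. 1 - norm (blinfun_apply S f)\<close>.
\<close>

lemma attain_norm_at_carrier:
  assumes cuc: "C_uniformly_convex TYPE('y::cbanach)" and \<epsilon>: "\<epsilon> > 0"
  obtains \<eta> where "\<eta> > 0"
    "\<And>(T :: 'l::topological_space c0 \<Rightarrow>\<^sub>L 'y) f.
      \<lbrakk>T \<in> clinear_ops; norm T = 1; norm f \<le> 1; carried_by T f;
       norm (blinfun_apply T f) \<ge> 1 - \<eta>\<rbrakk> \<Longrightarrow>
      \<exists>S \<in> clinear_ops. norm S = 1 \<and> norm (blinfun_apply S f) = 1 \<and> norm (S - T) \<le> \<epsilon>"
proof -
  have "\<exists>\<eta>>0. \<forall>(T :: 'l c0 \<Rightarrow>\<^sub>L 'y) f \<eta>'.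
      T \<in> clinear_ops \<and> norm T = 1 \<and> norm f \<le> 1 \<and> carried_by T f \<and>
       norm (blinfun_apply T f) \<ge> 1 - \<eta> \<and> \<eta>' > 0 \<longrightarrow>
      (\<exists>S \<in> clinear_ops. norm S = 1 \<and> carried_by S f \<and> norm (blinfun_apply S f) \<ge> 1 - \<eta>' \<and>
        norm (S - T) \<le> e)" if e: "e > 0" for e
    by (rule improvement_step[OF cuc e, where 'l = 'l]) blast
  then obtain \<eta> where \<eta>: "\<And>e. e > 0 \<Longrightarrow> \<eta> e > 0" and
    step: "\<And>e (T :: 'l c0 \<Rightarrow>\<^sub>L 'y) f \<eta>'. e > 0 \<Longrightarrow>
      T \<in> clinear_ops \<and> norm T = 1 \<and> norm f \<le> 1 \<and> carried_by T f \<and>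
       norm (blinfun_apply T f) \<ge> 1 - \<eta> e \<and> \<eta>' > 0 \<Longrightarrow>
      (\<exists>S \<in> clinear_ops. norm S = 1 \<and> carried_by S f \<and> norm (blinfun_apply S f) \<ge> 1 - \<eta>' \<and>
        norm (S - T) \<le> e)"
    by metis
  show thesis
  proof (rule that)
    show "\<eta> (\<epsilon> / 2) > 0" using \<eta> \<epsilon> by simp
    fix T :: "'l c0 \<Rightarrow>\<^sub>L 'y" and f
    assume T: "T \<in> clinear_ops" "norm T = 1" "carried_by T f" and f: "norm f \<le> 1"
      and large: "norm (blinfun_apply T f) \<ge> 1 - \<eta> (\<epsilon> / 2)"
    define A where "A = {S :: 'l c0 \<Rightarrow>\<^sub>L 'y. S \<in> clinear_ops \<and> norm S = 1 \<and> carried_by S f}"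
    define d where "d S = 1 - norm (blinfun_apply S f)" for S :: "'l c0 \<Rightarrow>\<^sub>L 'y"
    have [continuous_intros]: "continuous_on UNIV (\<lambda>S :: 'l c0 \<Rightarrow>\<^sub>L 'y. blinfun_apply S u)" for u
      by (intro continuous_intros)
    have C: "continuous_on UNIV (\<lambda>S :: 'l c0 \<Rightarrow>\<^sub>L 'y. c *\<^sub>C blinfun_apply S u)" for c u
      by (intro bounded_linear.continuous_on[OF bounded_linear_scaleC_right] continuous_intros)
    have closed: "closed A"
      unfolding A_def clinear_ops_def carried_by_def mem_Collect_eq
      by (intro closed_Collect_conj closed_Collect_all closed_Collect_eq C continuous_intros)
    have cont: "continuous_on A d"
      unfolding d_def by (intro continuous_intros)
    have nonneg: "d S \<ge> 0" if "S \<in> A" for S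
      using that norm_blinfun_apply_le[of S f] f by (simp add: A_def d_def)
    have improve: "\<exists>S'\<in>A. d S' \<le> \<eta>' \<and> norm (S' - S) \<le> e"
      if "e > 0" "S \<in> A" "d S \<le> \<eta> e" "\<eta>' > 0" for e S \<eta>'
    proof -
      have "\<exists>S' \<in> clinear_ops. norm S' = 1 \<and> carried_by S' f \<and>
          norm (blinfun_apply S' f) \<ge> 1 - \<eta>' \<and> norm (S' - S) \<le> e"
        by (rule step[OF that(1)]) (use that(2-4) f in \<open>auto simp: A_def d_def\<close>)
      then show ?thesis by (auto simp: A_def d_def)
    qed
    have start: "T \<in> A" "d T \<le> \<eta> (\<epsilon> / 2)"
      using T large by (simp_all add: A_def d_def)
    obtain S where "S \<in> A" "d S = 0" "norm (S - T) \<le> \<epsilon>"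
      by (rule exact_zero_by_iteration[where A = A and d = d and \<eta> = \<eta> and e = \<epsilon> and x = T,
            OF closed cont nonneg \<eta> improve \<epsilon> start])
    then show "\<exists>S \<in> clinear_ops. norm S = 1 \<and> norm (blinfun_apply S f) = 1 \<and> norm (S - T) \<le> \<epsilon>"
      by (auto simp: A_def d_def)
  qed
qed

section \<open>Concentrating an operator where a function is unimodular\<close>

text \<open>
  The operator is small on functions of modulus at most \<^term>\<open>\<lambda>x. 1 - cmod (apply_c0 f0 x)\<close>, hence it
  barely changes when it is cut off, by means of \<^term>\<open>\<rho>\<close>, to the set where \<^term>\<open>f0\<close> has modulus above a
  number \<^term>\<open>r\<close> close to 1. Truncating \<^term>\<open>f0\<close> at height \<^term>\<open>r\<close> and dividing by \<^term>\<open>r\<close> gives a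
  nearby function that is unimodular on that set.
\<close>

lemma carry_near_modulus_one:
  assumes cuc: "C_uniformly_convex TYPE('y::cbanach)" and \<epsilon>: "\<epsilon> > 0"
  obtains \<eta> where "\<eta> > 0"
    "\<And>(T :: 'l::topological_space c0 \<Rightarrow>\<^sub>L 'y) f0.
      \<lbrakk>T \<in> clinear_ops; norm T \<le> 1; norm f0 \<le> 1; norm (blinfun_apply T f0) \<ge> 1 - \<eta>\<rbrakk> \<Longrightarrow>
      \<exists>S \<in> clinear_ops. \<exists>f. norm S = 1 \<and> norm f \<le> 1 \<and> carried_by S f \<and>
        norm (blinfun_apply S f) \<ge> 1 - \<epsilon> \<and> norm (S - T) \<le> \<epsilon> \<and> norm (f - f0) \<le> \<epsilon>"
proof -
  define e where "e = min 1 \<epsilon>"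
  have e: "e > 0" "e \<le> 1" "e \<le> \<epsilon>" using \<epsilon> by (auto simp: e_def)
  define r where "r = 1 - e / 8"
  have r: "r > 0" "r < 1" "1 - r = e / 8" using e by (auto simp: r_def)
  have "(1 - r) * (e / 8) > 0" using e r by simp
  from operator_small_beside_near_maximizer[OF cuc this]
  obtain \<delta> where \<delta>: "\<delta> > 0" "\<And>(T :: 'l c0 \<Rightarrow>\<^sub>L 'y) m k.
      \<lbrakk>T \<in> clinear_ops; norm T \<le> 1; \<And>x. cmod (apply_c0 m x) + cmod (apply_c0 k x) \<le> 1;
       norm (blinfun_apply T m) \<ge> 1 - \<delta>\<rbrakk> \<Longrightarrow> norm (blinfun_apply T k) \<le> (1 - r) * (e / 8)"
    by metis
  show thesis
  proof (rule that)
    show "min \<delta> (e / 8) > 0" using \<delta>(1) e by simp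
    fix T :: "'l c0 \<Rightarrow>\<^sub>L 'y" and f0
    assume T: "T \<in> clinear_ops" "norm T \<le> 1" and f0: "norm f0 \<le> 1"
      and large: "norm (blinfun_apply T f0) \<ge> 1 - min \<delta> (e / 8)"
    define f where "f = (1 / r) *\<^sub>R comp_c0 (radial_cut r) f0"
    define \<rho> where "\<rho> = comp_c0 (\<lambda>z. complex_of_real (max 0 ((cmod z - r) / (1 - r)))) f0"
    have f: "apply_c0 f x = (1 / r) *\<^sub>R radial_cut r (apply_c0 f0 x)" for x
      by (simp add: f_def apply_c0_simps apply_radial_cut_c0 r)
    have \<rho>: "apply_c0 \<rho> x = complex_of_real (max 0 ((cmod (apply_c0 f0 x) - r) / (1 - r)))" for x
      unfolding \<rho>_def using r
      by (subst apply_comp_c0) (auto intro!: continuous_intros simp: divide_le_0_iff)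
    have cmod_f: "cmod (apply_c0 f x) = min r (cmod (apply_c0 f0 x)) / r" for x
      using r by (simp add: f norm_radial_cut)
    have norm_f: "norm f \<le> 1"
      by (rule norm_c0_le) (use r in \<open>simp add: cmod_f\<close>)
    have f_f0: "norm (f - f0) \<le> e / 4"
    proof (rule norm_c0_le)
      fix x
      let ?z = "apply_c0 f0 x"
      have "(1 / r) *\<^sub>R radial_cut r ?z - ?z
          = (1 / r - 1) *\<^sub>R radial_cut r ?z - (?z - radial_cut r ?z)"
        by (simp add: algebra_simps)
      then have "cmod (apply_c0 (f - f0) x)
          \<le> cmod ((1 / r - 1) *\<^sub>R radial_cut r ?z) + cmod (?z - radial_cut r ?z)"
        unfolding apply_c0_simps f by (simp only: norm_triangle_ineq4)
      also have "cmod (?z - radial_cut r ?z) \<le> 1 - r"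
        using cmod_apply_c0_le_one[OF f0, of x] r by (simp add: norm_diff_radial_cut)
      also have "cmod ((1 / r - 1) *\<^sub>R radial_cut r ?z) \<le> (1 / r - 1) * r"
        using r unfolding norm_scaleR by (intro mult_mono) (auto simp: norm_radial_cut)
      also have "(1 / r - 1) * r = 1 - r" using r by (simp add: algebra_simps)
      finally show "cmod (apply_c0 (f - f0) x) \<le> e / 4" using r by simp
    qed
    define T1 where "T1 = T o\<^sub>L Blinfun ((*) \<rho>)"
    have T1: "blinfun_apply T1 u = blinfun_apply T (\<rho> * u)" for u
      by (simp add: T1_def bounded_linear_Blinfun_apply bounded_linear_mult_right)
    have T1_clin: "T1 \<in> clinear_ops"
      using T(1) by (simp add: clinear_ops_def T1 scaleC_mult_c0)
    have T1_carried: "carried_by T1 f"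
      unfolding carried_by_def
    proof
      fix u
      have "\<rho> * (f * cnj_c0 f * u) = \<rho> * u"
      proof (rule c0_eqI)
        fix x
        have "apply_c0 \<rho> x = 0 \<or> cmod (apply_c0 f x) = 1"
          using r by (cases "cmod (apply_c0 f0 x) \<le> r") (auto simp: \<rho> cmod_f divide_le_0_iff max_absorb1)
        then have "apply_c0 \<rho> x = 0 \<or> apply_c0 f x * cnj (apply_c0 f x) = 1"
          by (auto simp: complex_norm_square[symmetric])
        then show "apply_c0 (\<rho> * (f * cnj_c0 f * u)) x = apply_c0 (\<rho> * u) x"
          by (auto simp: apply_c0_simps)
      qed
      then show "blinfun_apply T1 (f * cnj_c0 f * u) = blinfun_apply T1 u" by (simp add: T1)
    qed
    have norm_\<rho>: "norm \<rho> \<le> 1"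
      by (rule norm_c0_le) (use r cmod_apply_c0_le_one[OF f0] in \<open>auto simp: \<rho> max_def\<close>)
    have T1_le: "norm T1 \<le> 1"
    proof (rule norm_blinfun_le)
      fix u :: "'l c0" assume "norm u \<le> 1"
      then have "norm (\<rho> * u) \<le> 1" using norm_\<rho> by (intro norm_mult_le_one)
      then show "norm (blinfun_apply T1 u) \<le> 1"
        unfolding T1 using norm_blinfun_apply_le[OF T(2), of "\<rho> * u"] by simp
    qed
    have T1_T: "norm (T1 - T) \<le> e / 8"
    proof (rule norm_blinfun_le)
      fix u :: "'l c0" assume u: "norm u \<le> 1"
      define k where "k = (1 - r) *\<^sub>R (u - \<rho> * u)"
      have "norm (blinfun_apply T k) \<le> (1 - r) * (e / 8)"
      proof (rule \<delta>(2)[OF T, of f0])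
        fix x
        have le: "cmod (apply_c0 f0 x) \<le> 1" by (rule cmod_apply_c0_le_one[OF f0])
        let ?q = "max 0 ((cmod (apply_c0 f0 x) - r) / (1 - r))"
        have q: "?q \<le> 1" using r le by (simp add: divide_le_eq_1)
        have q_le: "(1 - r) * (1 - ?q) \<le> 1 - cmod (apply_c0 f0 x)"
        proof -
          have "cmod (apply_c0 f0 x) - r \<le> (1 - r) * ?q"
            using r mult_left_mono[of "(cmod (apply_c0 f0 x) - r) / (1 - r)" ?q "1 - r"] by simp
          then show ?thesis by (simp add: right_diff_distrib)
        qed
        have "apply_c0 k x = ((1 - r) * (1 - ?q)) *\<^sub>R apply_c0 u x"
          by (simp add: k_def apply_c0_simps \<rho> scaleR_conv_of_real algebra_simps)
        moreover have "0 \<le> (1 - r) * (1 - ?q)" using q r(2) by simp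
        ultimately have "cmod (apply_c0 k x) = ((1 - r) * (1 - ?q)) * cmod (apply_c0 u x)"
          by (simp only: norm_scaleR abs_of_nonneg)
        also have "\<dots> \<le> (1 - cmod (apply_c0 f0 x)) * 1"
          by (rule mult_mono[OF q_le]) (use le cmod_apply_c0_le_one[OF u, of x] in auto)
        finally show "cmod (apply_c0 f0 x) + cmod (apply_c0 k x) \<le> 1" by simp
      qed (use large in auto)
      moreover have "norm (blinfun_apply T k) = (1 - r) * norm (blinfun_apply T u - blinfun_apply T (\<rho> * u))"
        using r by (simp add: k_def blinfun.scaleR_right blinfun.diff_right)
      ultimately have "norm (blinfun_apply T u - blinfun_apply T (\<rho> * u)) \<le> e / 8"
        using r by simp
      then show "norm (blinfun_apply (T1 - T) u) \<le> e / 8"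
        by (simp add: blinfun.diff_left T1 norm_minus_commute)
    qed
    have T1f: "norm (blinfun_apply T1 f) \<ge> 1 - e / 2"
    proof -
      have "norm (blinfun_apply T1 f - blinfun_apply (T1 - T) f - blinfun_apply T (f - f0))
          \<le> norm (blinfun_apply T1 f) + norm (blinfun_apply (T1 - T) f) + norm (blinfun_apply T (f - f0))"
        by (rule order_trans[OF norm_triangle_ineq4 add_right_mono[OF norm_triangle_ineq4]])
      then have "norm (blinfun_apply T f0) \<le> norm (blinfun_apply T1 f)
          + norm (blinfun_apply (T1 - T) f) + norm (blinfun_apply T (f - f0))"
        by (simp add: blinfun.diff_left blinfun.diff_right)
      moreover have "norm (blinfun_apply (T1 - T) f) \<le> e / 8"
        using norm_blinfun[of "T1 - T" f] T1_T norm_f mult_mono[OF T1_T norm_f] e by simp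
      moreover have "norm (blinfun_apply T (f - f0)) \<le> e / 4"
        using norm_blinfun_apply_le[OF T(2), of "f - f0"] f_f0 by simp
      ultimately show ?thesis using large by simp
    qed
    have T1_ge: "norm T1 \<ge> 1 - e / 2"
      using T1f norm_blinfun[of T1 f] mult_left_mono[OF norm_f, of "norm T1"] by simp
    then have nz: "T1 \<noteq> 0" using e by auto
    define S where "S = (1 / norm T1) *\<^sub>R T1"
    have "norm (blinfun_apply S f) \<ge> norm (blinfun_apply T1 f)"
    proof -
      have "norm (blinfun_apply T1 f) * norm T1 \<le> norm (blinfun_apply T1 f) * 1"
        by (intro mult_left_mono T1_le) auto
      then show ?thesis
        using nz by (simp add: S_def scaleR_blinfun.rep_eq field_simps)
    qed
    then have "norm (blinfun_apply S f) \<ge> 1 - \<epsilon>" using T1f e by simp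
    moreover have "norm (S - T) \<le> \<epsilon>"
      using norm_triangle_ineq[of "S - T1" "T1 - T"] norm_normalized_diff[OF nz] T1_ge T1_le T1_T e
      by (simp add: S_def)
    moreover have "norm (f - f0) \<le> \<epsilon>" using f_f0 e by simp
    ultimately show "\<exists>S \<in> clinear_ops. \<exists>f. norm S = 1 \<and> norm f \<le> 1 \<and> carried_by S f \<and>
        norm (blinfun_apply S f) \<ge> 1 - \<epsilon> \<and> norm (S - T) \<le> \<epsilon> \<and> norm (f - f0) \<le> \<epsilon>"
      using nz norm_f T1_clin T1_carried
      by (intro bexI[of _ S] exI[of _ f]) (auto simp: S_def clinear_ops_scaleR carried_by_scaleR)
  qed
qed

section \<open>Sufficiency of complex uniform convexity\<close>

lemma C_uniformly_convex_imp_BPBp_RSE: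
  assumes cuc: "C_uniformly_convex TYPE('y::cbanach)"
  shows "BPBp_RSE TYPE('l::topological_space c0) TYPE('y)"
  unfolding BPBp_RSE_def
proof (intro allI impI)
  fix \<epsilon> :: real assume \<epsilon>: "\<epsilon> > 0"
  then have "\<epsilon> / 4 > 0" by simp
  from attain_norm_at_carrier[OF cuc this]
  obtain \<eta>1 where \<eta>1: "\<eta>1 > 0" "\<And>(T :: 'l c0 \<Rightarrow>\<^sub>L 'y) f.
      \<lbrakk>T \<in> clinear_ops; norm T = 1; norm f \<le> 1; carried_by T f; norm (blinfun_apply T f) \<ge> 1 - \<eta>1\<rbrakk> \<Longrightarrow>
      \<exists>S \<in> clinear_ops. norm S = 1 \<and> norm (blinfun_apply S f) = 1 \<and> norm (S - T) \<le> \<epsilon> / 4"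
    by metis
  define \<epsilon>' where "\<epsilon>' = min \<eta>1 (\<epsilon> / 4)"
  have "\<epsilon>' > 0" using \<eta>1(1) \<epsilon> by (simp add: \<epsilon>'_def)
  from carry_near_modulus_one[OF cuc this]
  obtain \<eta>2 where \<eta>2: "\<eta>2 > 0" "\<And>(T :: 'l c0 \<Rightarrow>\<^sub>L 'y) f0.
      \<lbrakk>T \<in> clinear_ops; norm T \<le> 1; norm f0 \<le> 1; norm (blinfun_apply T f0) \<ge> 1 - \<eta>2\<rbrakk> \<Longrightarrow>
      \<exists>S \<in> clinear_ops. \<exists>f. norm S = 1 \<and> norm f \<le> 1 \<and> carried_by S f \<and>
        norm (blinfun_apply S f) \<ge> 1 - \<epsilon>' \<and> norm (S - T) \<le> \<epsilon>' \<and> norm (f - f0) \<le> \<epsilon>'"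
    by metis
  show "\<exists>\<eta>. 0 < \<eta> \<and> \<eta> < \<epsilon> \<and>
      (\<forall>T \<in> (clinear_ops :: ('l c0 \<Rightarrow>\<^sub>L 'y) set). \<forall>x.
         norm T = 1 \<and> norm x = 1 \<and> norm (blinfun_apply T x) > 1 - \<eta> \<longrightarrow>
         (\<exists>S \<in> RSE. \<exists>x0. norm x0 = 1 \<and> norm S = 1 \<and> norm (blinfun_apply S x0) = 1 \<and>
            norm (S - T) < \<epsilon> \<and> norm (x - x0) < \<epsilon>))"
  proof (intro exI[of _ "min \<eta>2 (\<epsilon> / 2)"] conjI ballI allI impI)
    fix T :: "'l c0 \<Rightarrow>\<^sub>L 'y" and f0
    assume T: "T \<in> clinear_ops"
      and "norm T = 1 \<and> norm f0 = 1 \<and> norm (blinfun_apply T f0) > 1 - min \<eta>2 (\<epsilon> / 2)"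
    then have "norm T = 1" "norm f0 = 1" "norm (blinfun_apply T f0) \<ge> 1 - \<eta>2" by auto
    then obtain S1 f where S1: "S1 \<in> clinear_ops" "norm S1 = 1" "norm f \<le> 1" "carried_by S1 f"
        "norm (blinfun_apply S1 f) \<ge> 1 - \<epsilon>'" "norm (S1 - T) \<le> \<epsilon>'" "norm (f - f0) \<le> \<epsilon>'"
      using \<eta>2(2)[OF T, of f0] by auto
    have \<epsilon>'_le: "\<epsilon>' \<le> \<eta>1" "\<epsilon>' \<le> \<epsilon> / 4" by (auto simp: \<epsilon>'_def)
    then have "norm (blinfun_apply S1 f) \<ge> 1 - \<eta>1" using S1(5) by linarith
    then obtain S2 where S2: "S2 \<in> clinear_ops" "norm S2 = 1" "norm (blinfun_apply S2 f) = 1"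
        "norm (S2 - S1) \<le> \<epsilon> / 4"
      using \<eta>1(2)[OF S1(1-4)] by blast
    have f: "norm f = 1"
      using norm_blinfun_apply_le[of S2 f] S1(3) S2 by simp
    obtain S where S: "S \<in> RSE" "norm S = 1" "blinfun_apply S f = blinfun_apply S2 f"
        "norm (S - S2) \<le> 2 * (\<epsilon> / 8)"
      using norm_attaining_near_RSE[OF cuc S2(1,2) f S2(3), of "\<epsilon> / 8"] \<epsilon> by auto
    have "norm (S - T) \<le> norm (S - S2) + norm (S2 - S1) + norm (S1 - T)"
      using norm_triangle_ineq[of "S - S2" "S2 - S1"] norm_triangle_ineq[of "S - S1" "S1 - T"] by simp
    then have "norm (S - T) < \<epsilon>"
      using S(4) S2(4) S1(6) \<epsilon>'_le(2) \<epsilon> by linarith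
    then show "\<exists>S \<in> RSE. \<exists>x0. norm x0 = 1 \<and> norm S = 1 \<and> norm (blinfun_apply S x0) = 1 \<and>
        norm (S - T) < \<epsilon> \<and> norm (f0 - x0) < \<epsilon>"
      using S S2 f S1(7) \<epsilon>'_le(2) \<epsilon>
      by (intro bexI[of _ S] exI[of _ f]) (auto simp: norm_minus_commute)
  qed (use \<eta>2(1) \<epsilon> in auto)
qed

section \<open>Necessity of complex uniform convexity\<close>

text \<open>
  Local compactness enters twice: it makes the space completely regular, and it provides a
  compact neighbourhood of the point outside which the separating function is made to vanish.
\<close>

lemma bump_function:
  fixes U :: "'l::t2_space set"
  assumes lc: "locally_compact_space (euclidean :: 'l topology)" and U: "open U" "t \<in> U"
  obtains f :: "'l c0" where "apply_c0 f t = 1" "norm f = 1" "\<And>x. x \<notin> U \<Longrightarrow> apply_c0 f x = 0"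
proof -
  have "Hausdorff_space (euclidean :: 'l topology)"
    unfolding Hausdorff_space_def disjnt_def by simp (metis hausdorff)
  then have "completely_regular_space (euclidean :: 'l topology)"
    using lc locally_compact_regular_imp_completely_regular_space by blast
  moreover obtain V K where VK: "open V" "compact K" "t \<in> V" "V \<subseteq> K"
    using lc unfolding locally_compact_space_def by simp metis
  then have "closedin euclidean (- (U \<inter> V)) \<and> t \<in> topspace euclidean - (- (U \<inter> V))"
    using U by (auto simp: closed_Compl)
  ultimately obtain h :: "'l \<Rightarrow> real" where h: "continuous_map euclidean (top_of_set {0..1}) h"
    "h t = 0" "h ` (- (U \<inter> V)) \<subseteq> {1}"
    unfolding completely_regular_space_def by meson
  have cont: "continuous_on UNIV h" and range: "\<And>x. h x \<in> {0..1}"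
    using h(1) by (auto simp: continuous_map_in_subtopology)
  define F where "F x = complex_of_real (1 - h x)" for x
  have F0: "F x = 0" if "x \<notin> U \<inter> V" for x
    using h(3) that by (auto simp: F_def)
  have "continuous_on UNIV F" unfolding F_def by (intro continuous_intros cont)
  moreover have "vanishes_at_infinity F"
    unfolding vanishes_at_infinity_def
  proof (intro allI impI exI[of _ K] conjI)
    fix e :: real and x assume "e > 0" "x \<notin> K"
    moreover from this have "F x = 0" using VK by (intro F0) blast
    ultimately show "cmod (F x) < e" by simp
  qed (use VK in auto)
  ultimately have F: "apply_c0 (Abs_c0 F) = F" by (simp add: Abs_c0_inverse)
  show thesis
  proof (rule that[of "Abs_c0 F"])
    show 1: "apply_c0 (Abs_c0 F) t = 1" by (simp add: F F_def h(2))
    show "norm (Abs_c0 F) = 1"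
    proof (rule antisym)
      show "norm (Abs_c0 F) \<le> 1"
      proof (rule norm_c0_le)
        fix x
        have "cmod (F x) = 1 - h x" unfolding F_def norm_of_real using range[of x] by simp
        then show "cmod (apply_c0 (Abs_c0 F) x) \<le> 1" using range[of x] by (simp add: F)
      qed
      show "1 \<le> norm (Abs_c0 F)" using cmod_apply_c0_le_norm[of "Abs_c0 F" t] 1 by simp
    qed
  qed (simp add: F F0)
qed

text \<open>
  This is what the definition says about constant sequences: all values of maximal norm are
  rotations of one vector.
\<close>

lemma RSE_attained_values:
  assumes "S \<in> RSE"
  obtains z where "\<And>u. norm u \<le> 1 \<Longrightarrow> norm (blinfun_apply S u) = norm S \<Longrightarrow>
    \<exists>\<theta>. cmod \<theta> = 1 \<and> blinfun_apply S u = \<theta> *\<^sub>C z"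
proof -
  obtain x0 where x0: "\<And>x. (\<forall>n. norm (x n) \<le> 1) \<Longrightarrow>
      (\<lambda>n. norm (blinfun_apply S (x n))) \<longlonglongrightarrow> norm S \<Longrightarrow>
      \<exists>\<sigma> :: nat \<Rightarrow> nat. \<exists>\<theta>. strict_mono \<sigma> \<and> cmod \<theta> = 1 \<and>
        (\<lambda>n. blinfun_apply S (x (\<sigma> n))) \<longlonglongrightarrow> \<theta> *\<^sub>C blinfun_apply S x0"
    using assms unfolding RSE_def by auto
  show thesis
  proof (rule that[of "blinfun_apply S x0"])
    fix u assume "norm u \<le> 1" "norm (blinfun_apply S u) = norm S"
    then show "\<exists>\<theta>. cmod \<theta> = 1 \<and> blinfun_apply S u = \<theta> *\<^sub>C blinfun_apply S x0"
      using x0[of "\<lambda>_. u"] by (auto simp: LIMSEQ_const_iff)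
  qed
qed

text \<open>
  The value at \<^term>\<open>x\<close> is the midpoint of the values at \<^term>\<open>x + v\<close> and \<^term>\<open>x - v\<close>, so all three
  have norm 1. The operator being range strongly exposing, they are unimodular multiples of one vector;
  a point of the unit circle is the midpoint of two such points only if all coincide.
\<close>

lemma RSE_vanishes_beside_maximizer:
  assumes S: "S \<in> RSE" "norm S = 1" and x: "norm (blinfun_apply S x) = 1"
    and v: "norm (x + v) \<le> 1" "norm (x - v) \<le> 1"
  shows "blinfun_apply S v = 0"
proof -
  let ?S = "blinfun_apply S"
  have le: "norm (?S u) \<le> 1" if "norm u \<le> 1" for u
    using norm_blinfun[of S u] that S(2) by simp
  have two: "2 *\<^sub>R ?S x = ?S (x + v) + ?S (x - v)"
    by (simp add: blinfun.add_right blinfun.diff_right scaleR_2)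
  have "2 = norm (2 *\<^sub>R ?S x)" by (simp add: x)
  also have "\<dots> \<le> norm (?S (x + v)) + norm (?S (x - v))"
    unfolding two by (rule norm_triangle_ineq)
  finally have one: "norm (?S (x + v)) = 1" "norm (?S (x - v)) = 1"
    using le[OF v(1)] le[OF v(2)] by linarith+
  have "norm (2 *\<^sub>R x) \<le> 2"
    using norm_triangle_ineq[of "x + v" "x - v"] v by (simp add: scaleR_2)
  then have "norm x \<le> 1" by simp
  obtain z where z: "\<And>u. norm u \<le> 1 \<Longrightarrow> norm (?S u) = norm S \<Longrightarrow> \<exists>\<theta>. cmod \<theta> = 1 \<and> ?S u = \<theta> *\<^sub>C z"
    using RSE_attained_values[OF S(1)] by metis
  obtain a b c where abc: "cmod a = 1" "?S (x + v) = a *\<^sub>C z" "cmod b = 1" "?S (x - v) = b *\<^sub>C z"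
    "cmod c = 1" "?S x = c *\<^sub>C z"
    using z[OF v(1)] z[OF v(2)] z[OF \<open>norm x \<le> 1\<close>] one x S(2) by metis
  have "norm z = 1" using one(1) abc by (simp add: norm_scaleC)
  have "(2 * c) *\<^sub>C z = (a + b) *\<^sub>C z"
    using two abc by (simp add: scaleR_scaleC scaleC_scaleC scaleC_add_left)
  then have "2 * c = a + b"
    using \<open>norm z = 1\<close> by (subst (asm) complex_vector.scale_cancel_right) auto
  then have "cmod (a + b) = 2" using abc(5) by (metis mult.right_neutral norm_mult norm_numeral)
  then have "a = b" using cmod_parallelogram[of a b] abc by simp
  then have "a = c" using \<open>2 * c = a + b\<close> by simp
  then have "?S (x + v) = ?S x" using abc by simp
  then show ?thesis by (simp add: blinfun.add_right)
qed

text \<open>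
  The two points are where the chord perpendicular to the ray through \<^term>\<open>a\<close> meets the circle.
\<close>

lemma disc_average:
  assumes "cmod a \<le> 1"
  obtains p q where "cmod p = 1" "cmod q = 1" "a = (1/2) * (p + q)"
proof -
  obtain s where s: "cmod s = 1" "s * a = cmod a" using exists_unimodular_mult by blast
  define w where "w = Complex (cmod a) (sqrt (1 - (cmod a)\<^sup>2))"
  have "(cmod a)\<^sup>2 \<le> 1" using assms by (simp add: power_le_one)
  then have "(cmod w)\<^sup>2 = 1" using cmod_power2[of w] by (simp add: w_def)
  then have w: "cmod w = 1" by (simp add: power2_eq_1_iff) (smt (verit) norm_ge_zero)
  have "w + cnj w = 2 * (s * a)" by (simp add: s w_def complex_eq_iff)
  moreover have "inverse s * s = 1" using s(1) by (metis left_inverse norm_zero zero_neq_one)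
  ultimately have "a = (1/2) * (inverse s * w + inverse s * cnj w)"
    by (metis (no_types) distrib_left mult.assoc mult.left_commute mult_1 nonzero_eq_divide_eq
        times_divide_eq_left zero_neq_numeral mult.commute)
  then show thesis
    by (intro that[of "inverse s * w" "inverse s * cnj w"]) (simp_all add: norm_mult norm_inverse s w)
qed

lemma norm_combination_le:
  fixes y0 y1 :: "'y::complex_normed_vector"
  assumes "\<And>w. cmod w = 1 \<Longrightarrow> norm (y0 + w *\<^sub>C y1) \<le> 1" "cmod a \<le> 1" "cmod b \<le> 1"
  shows "norm (a *\<^sub>C y0 + b *\<^sub>C y1) \<le> 1"
proof -
  have circle: "norm (p *\<^sub>C y0 + q *\<^sub>C y1) \<le> 1" if "cmod p = 1" "cmod q = 1" for p q
  proof -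
    have "p \<noteq> 0" using that by auto
    then have "p *\<^sub>C y0 + q *\<^sub>C y1 = p *\<^sub>C (y0 + (q / p) *\<^sub>C y1)"
      by (simp add: scaleC_add_right scaleC_scaleC)
    then show ?thesis using assms(1)[of "q / p"] that by (simp add: norm_scaleC norm_divide)
  qed
  have half: "norm ((1/2) *\<^sub>R (u + v)) \<le> 1" if "norm u \<le> 1" "norm v \<le> 1" for u v :: 'y
    using norm_triangle_ineq[of u v] that by simp
  have double: "u + ((1/2) * (p + q)) *\<^sub>C v = (1/2) *\<^sub>R ((u + p *\<^sub>C v) + (u + q *\<^sub>C v))" for p q and u v :: 'y
  proof -
    have "(u + p *\<^sub>C v) + (u + q *\<^sub>C v) = (u + u) + (p + q) *\<^sub>C v"
      by (simp add: scaleC_add_left)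
    moreover have "((1/2) * (p + q)) *\<^sub>C v = (1/2) *\<^sub>R (p + q) *\<^sub>C v"
      by (simp add: scaleR_scaleC scaleC_scaleC)
    ultimately show ?thesis by (simp only: scaleR_add_right[of _ "u + u"] scaleR_half_double)
  qed
  have double': "((1/2) * (p + q)) *\<^sub>C v + u = (1/2) *\<^sub>R ((p *\<^sub>C v + u) + (q *\<^sub>C v + u))" for p q and u v :: 'y
    using double[of u p q v] by (simp only: add.commute)
  have mixed: "norm (p *\<^sub>C y0 + b *\<^sub>C y1) \<le> 1" if "cmod p = 1" for p
  proof -
    obtain q q' where q: "cmod q = 1" "cmod q' = 1" "b = (1/2) * (q + q')"
      using disc_average[OF assms(3)] .
    have "p *\<^sub>C y0 + b *\<^sub>C y1 = (1/2) *\<^sub>R ((p *\<^sub>C y0 + q *\<^sub>C y1) + (p *\<^sub>C y0 + q' *\<^sub>C y1))"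
      unfolding q(3) double ..
    then show ?thesis by (simp only: half circle that q(1,2))
  qed
  obtain p p' where p: "cmod p = 1" "cmod p' = 1" "a = (1/2) * (p + p')"
    using disc_average[OF assms(2)] .
  have "a *\<^sub>C y0 + b *\<^sub>C y1 = (1/2) *\<^sub>R ((p *\<^sub>C y0 + b *\<^sub>C y1) + (p' *\<^sub>C y0 + b *\<^sub>C y1))"
    unfolding p(3) double' ..
  then show ?thesis by (simp only: half mixed p(1,2))
qed

text \<open>
  Split the space into nonempty disjoint open sets \<^term>\<open>A\<close> and \<^term>\<open>B\<close>, choose a point in each, and
  suppose \<^term>\<open>y0\<close>, \<^term>\<open>y1\<close> violate complex uniform convexity. The operator that sends \<^term>\<open>u\<close> to
  \<^term>\<open>u1 *\<^sub>C y0 + u2 *\<^sub>C y1\<close>, where \<^term>\<open>u1\<close> and \<^term>\<open>u2\<close> are the values of \<^term>\<open>u\<close> at the two points,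
  almost attains its norm at a function vanishing on \<^term>\<open>B\<close>. An approximating range strongly exposing
  operator attains its norm at a function of modulus at most 1/2 on \<^term>\<open>B\<close>, hence kills
  functions supported in \<^term>\<open>B\<close> of norm at most 1/2. The given operator does not, because
  \<^term>\<open>y1\<close> is not small.
\<close>

lemma BPBp_RSE_imp_C_uniformly_convex:
  assumes lc: "locally_compact_space (euclidean :: 'l::t2_space topology)"
    and disc: "\<not> connected (UNIV :: 'l set)"
    and BPB: "BPBp_RSE TYPE('l c0) TYPE('y::cbanach)"
  shows "C_uniformly_convex TYPE('y)"
proof (rule ccontr)
  assume "\<not> C_uniformly_convex TYPE('y)"
  then obtain \<epsilon> where \<epsilon>: "\<epsilon> > 0" and bad: "\<And>\<delta>. \<delta> > 0 \<Longrightarrow> \<exists>y0 y1 :: 'y.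
      (\<forall>w. cmod w = 1 \<longrightarrow> norm (y0 + w *\<^sub>C y1) \<le> 1) \<and> norm y1 > \<epsilon> \<and> norm y0 \<ge> 1 - \<delta>"
    unfolding C_uniformly_convex_def by (metis not_le)
  define e where "e = min \<epsilon> (1/2)"
  have e: "e > 0" "e \<le> \<epsilon>" "e \<le> 1/2" using \<epsilon> by (auto simp: e_def)
  obtain \<eta> where \<eta>: "0 < \<eta>" "\<eta> < e" and approx: "\<And>(T :: 'l c0 \<Rightarrow>\<^sub>L 'y) x.
      T \<in> clinear_ops \<Longrightarrow> norm T = 1 \<and> norm x = 1 \<and> norm (blinfun_apply T x) > 1 - \<eta> \<Longrightarrow>
      \<exists>S \<in> RSE. \<exists>x0. norm x0 = 1 \<and> norm S = 1 \<and> norm (blinfun_apply S x0) = 1 \<and>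
        norm (S - T) < e \<and> norm (x - x0) < e"
    using BPB e(1) unfolding BPBp_RSE_def by metis
  obtain y0 y1 :: 'y where y: "\<And>w. cmod w = 1 \<Longrightarrow> norm (y0 + w *\<^sub>C y1) \<le> 1" "norm y1 > \<epsilon>"
      "norm y0 \<ge> 1 - \<eta> / 2"
    using bad[of "\<eta> / 2"] \<eta> by auto
  obtain A B :: "'l set" where AB: "open A" "open B" "A \<inter> B = {}" "A \<union> B = UNIV" "A \<noteq> {}" "B \<noteq> {}"
    using disc unfolding connected_def by auto
  obtain t1 t2 where t: "t1 \<in> A" "t2 \<in> B" using AB by blast
  obtain x where x: "apply_c0 x t1 = 1" "norm x = 1" "\<And>z. z \<notin> A \<Longrightarrow> apply_c0 x z = 0"
    using bump_function[OF lc AB(1) t(1)] by metis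
  obtain w where w: "apply_c0 w t2 = 1" "norm w = 1" "\<And>z. z \<notin> B \<Longrightarrow> apply_c0 w z = 0"
    using bump_function[OF lc AB(2) t(2)] by metis
  have eval: "bounded_linear (\<lambda>u. apply_c0 u z)" for z :: 'l
    by (rule bounded_linear_intro[of _ 1]) (simp_all add: apply_c0_simps cmod_apply_c0_le_norm)
  define T0 where "T0 = Blinfun (\<lambda>u :: 'l c0. apply_c0 u t1 *\<^sub>C y0 + apply_c0 u t2 *\<^sub>C y1)"
  have T0: "blinfun_apply T0 u = apply_c0 u t1 *\<^sub>C y0 + apply_c0 u t2 *\<^sub>C y1" for u
    unfolding T0_def
    by (subst bounded_linear_Blinfun_apply)
      (intro bounded_linear_add bounded_linear_compose[OF bounded_linear_scaleC_left eval], simp)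
  have T0_clin: "T0 \<in> clinear_ops"
    by (simp add: clinear_ops_def T0 apply_c0_simps scaleC_add_right scaleC_scaleC)
  have T0_le: "norm T0 \<le> 1"
    by (rule norm_blinfun_le) (simp add: T0 norm_combination_le[OF y(1)] cmod_apply_c0_le_one)
  have T0x: "blinfun_apply T0 x = y0"
    using x(1) x(3)[of t2] t AB by (auto simp: T0)
  have T0_ge: "norm T0 \<ge> norm y0" using norm_blinfun[of T0 x] x(2) T0x by simp
  have y0_pos: "norm y0 > 0" using y(3) \<eta> e by linarith
  define T where "T = (1 / norm T0) *\<^sub>R T0"
  have nz: "norm T0 > 0" using T0_ge y0_pos by linarith
  have T_ge: "norm (blinfun_apply T0 u) \<le> norm (blinfun_apply T u)" for u
  proof -
    have "norm (blinfun_apply T0 u) * norm T0 \<le> norm (blinfun_apply T0 u) * 1"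
      by (intro mult_left_mono T0_le) auto
    then show ?thesis using nz by (simp add: T_def scaleR_blinfun.rep_eq field_simps)
  qed
  have "norm T = 1" using nz by (simp add: T_def)
  moreover have "norm (blinfun_apply T x) > 1 - \<eta>"
    using T_ge[of x] T0x y(3) \<eta>(1) by simp
  ultimately obtain S x0 where S: "S \<in> RSE" "norm x0 = 1" "norm S = 1" "norm (blinfun_apply S x0) = 1"
      "norm (S - T) < e" "norm (x - x0) < e"
    using approx[of T x] T0_clin x(2) by (auto simp: T_def clinear_ops_scaleR)
  \<comment> \<open>On \<^term>\<open>B\<close>, where \<^term>\<open>v\<close> lives, the function \<^term>\<open>x0\<close> has modulus at most 1/2, because
    \<^term>\<open>x\<close> vanishes there.\<close>
  define v where "v = (1/2) *\<^sub>R w"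
  have sum_le: "cmod (apply_c0 x0 z) + cmod (apply_c0 v z) \<le> 1" for z
  proof (cases "z \<in> B")
    case True
    then have "apply_c0 x z = 0" using x(3)[of z] AB(3) by auto
    then have "cmod (apply_c0 x0 z) \<le> 1/2"
      using cmod_apply_c0_le_norm[of "x - x0" z] S(6) e(3) by (simp add: apply_c0_simps)
    then show ?thesis
      using cmod_apply_c0_le_one[of w z] w(2) by (simp add: v_def apply_c0_simps)
  next
    case False
    then show ?thesis
      using w(3)[of z] cmod_apply_c0_le_one[of x0 z] S(2) by (simp add: v_def apply_c0_simps)
  qed
  have "norm (x0 + v) \<le> 1"
    by (rule norm_c0_le) (use order_trans[OF norm_triangle_ineq sum_le] in \<open>simp add: apply_c0_simps\<close>)
  moreover have "norm (x0 - v) \<le> 1"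
    by (rule norm_c0_le) (use order_trans[OF norm_triangle_ineq4 sum_le] in \<open>simp add: apply_c0_simps\<close>)
  ultimately have Sv: "blinfun_apply S v = 0" by (rule RSE_vanishes_beside_maximizer[OF S(1,3,4)])
  have "blinfun_apply T0 v = (1/2) *\<^sub>R y1"
    using w(1) w(3)[of t1] t AB by (auto simp: T0 v_def apply_c0_simps scaleC_of_real[symmetric])
  then have "\<epsilon> / 2 < norm (blinfun_apply T v)"
    using T_ge[of v] y(2) by simp
  moreover have "norm (blinfun_apply T v) = norm (blinfun_apply (S - T) v)"
    by (simp add: blinfun.diff_left Sv)
  moreover have "norm (blinfun_apply (S - T) v) \<le> norm (S - T) * (1/2)"
    using norm_blinfun[of "S - T" v] w(2) by (simp add: v_def)
  ultimately show False using S(5) e(2) by linarith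
qed

theorem theorem3p5:
  assumes "locally_compact_space (euclidean :: 'l::t2_space topology)"
    and "cdim_ge 2 TYPE('l c0)"
    and "cdim_ge 2 TYPE('y::cbanach)"
  shows "(C_uniformly_convex TYPE('y) \<longrightarrow> BPBp_RSE TYPE('l c0) TYPE('y)) \<and>
    (\<not> connected (UNIV :: 'l set) \<longrightarrow>
      BPBp_RSE TYPE('l c0) TYPE('y) \<longrightarrow> C_uniformly_convex TYPE('y))"
  using C_uniformly_convex_imp_BPBp_RSE BPBp_RSE_imp_C_uniformly_convex[OF assms(1)] by blast

end
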